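(* Let $G=(V,E)$ be a directed graph with non-negative edge costs $c_e$ ($e\in E$), a root $r\in V$ and a set of terminals $X\subseteq V$ with $k=|X|$, and suppose the instance is quasi-bipartite, i.e. no edge of $E$ has both endpoints in $V\setminus(X\cup\{r\})$. Let $OPT_{LP}$ be the optimum value of the linear program \[\min \sum_{e\in E} c_e x_e \quad\text{s.t.}\quad x(\delta^{\rm in}(S))\ge 1 \ \ \forall\, S\subseteq V\setminus\{r\} \text{ with } S\cap X\neq\emptyset,\qquad x_e\ge 0\ \ \forall e\in E,\] and let $OPT_G$ be the minimum cost of a directed Steiner tree for this instance. Then $OPT_G\le 2H_k\cdot OPT_{LP}$, i.e. the integrality gap of this LP is at most $2H_k=O(\log k)$ on quasi-bipartite instances. Furthermore, a directed Steiner tree of cost at most $2H_k\cdot OPT_{LP}$ can be constructed in polynomial time.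
   Context: Directed Steiner tree (DST): given $G=(V,E)$, costs $c_e\ge 0$, terminals $X\subseteq V$ and root $r\in V$, find a minimum-cost edge set $F\subseteq E$ such that for every $t\in X$ there is a directed $r,t$-path using only edges of $F$. Nodes in $V\setminus(X\cup\{r\})$ are called Steiner nodes. For $S\subseteq V$, $\delta^{\rm in}(S)=\{uv\in E: u\notin S,\ v\in S\}$, and $x(F)=\sum_{e\in F}x_e$. $H_k=\sum_{i=1}^k 1/i$ is the $k$-th harmonic number. *)

theory Defs
  imports
    "HOL-Analysis.Harmonic_Numbers"
    "HOL-Library.Extended_Real"
    "HOL-Library.Landau_Symbols"
    "HOL-Library.Log_Nat"
    "HOL-Computational_Algebra.Polynomial"
    "Graph_Theory.Pair_Digraph"
begin

section \<open>Directed Steiner tree and its cut relaxation\<close>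

locale dst_instance = pair_fin_digraph G
  for G :: "'a pair_pre_digraph" +
  fixes c :: "'a \<times> 'a \<Rightarrow> real" and r :: 'a and X :: "'a set"
  assumes cost_nonneg: "\<And>e. e \<in> parcs G \<Longrightarrow> 0 \<le> c e"
    and root_in_verts: "r \<in> pverts G"
    and terminals_in_verts: "X \<subseteq> pverts G"

definition quasi_bipartite :: "'a pair_pre_digraph \<Rightarrow> 'a \<Rightarrow> 'a set \<Rightarrow> bool" where
  "quasi_bipartite G r X \<longleftrightarrow>
     \<not> (\<exists>(u, v) \<in> parcs G. u \<in> pverts G - (X \<union> {r}) \<and> v \<in> pverts G - (X \<union> {r}))"

definition directed_steiner_tree ::
    "'a pair_pre_digraph \<Rightarrow> 'a \<Rightarrow> 'a set \<Rightarrow> ('a \<times> 'a) set \<Rightarrow> bool" where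
  "directed_steiner_tree G r X F \<longleftrightarrow> F \<subseteq> parcs G \<and>
     (\<forall>t\<in>X. \<exists>p. pre_digraph.apath (with_proj \<lparr>pverts = pverts G, parcs = F\<rparr>) r p t)"

text \<open>
  The two optimum values are extended reals, being \<open>\<infinity>\<close> exactly when there is no feasible solution
  (this happens for both simultaneously, namely when some terminal is not reachable from the root).
  Otherwise both infima are attained: the first one ranges over a finite set, the second one is the
  value of a feasible linear program bounded below by 0.
\<close>

definition opt_dst ::
    "'a pair_pre_digraph \<Rightarrow> ('a \<times> 'a \<Rightarrow> real) \<Rightarrow> 'a \<Rightarrow> 'a set \<Rightarrow> ereal" where
  "opt_dst G c r X = (INF F \<in> {F. directed_steiner_tree G r X F}. ereal (\<Sum>e\<in>F. c e))"

definition delta_in :: "'a pair_pre_digraph \<Rightarrow> 'a set \<Rightarrow> ('a \<times> 'a) set" where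
  "delta_in G S = {(u, v) \<in> parcs G. u \<notin> S \<and> v \<in> S}"

definition lp_feasible ::
    "'a pair_pre_digraph \<Rightarrow> 'a \<Rightarrow> 'a set \<Rightarrow> ('a \<times> 'a \<Rightarrow> real) \<Rightarrow> bool" where
  "lp_feasible G r X x \<longleftrightarrow>
     (\<forall>S. S \<subseteq> pverts G - {r} \<and> S \<inter> X \<noteq> {} \<longrightarrow> (\<Sum>e\<in>delta_in G S. x e) \<ge> 1) \<and>
     (\<forall>e\<in>parcs G. x e \<ge> 0)"

definition opt_lp ::
    "'a pair_pre_digraph \<Rightarrow> ('a \<times> 'a \<Rightarrow> real) \<Rightarrow> 'a \<Rightarrow> 'a set \<Rightarrow> ereal" where
  "opt_lp G c r X = (INF x \<in> {x. lp_feasible G r X x}. ereal (\<Sum>e\<in>parcs G. c e * x e))"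


section \<open>Polynomial time\<close>

text \<open>
  The machine model is a WHILE language over binary trees with integer leaves, in variable-free
  form: a program transforms one tree into another. Time is bit cost. Every instruction is charged
  for the bits that it reads and writes, with integers in binary, so a run of cost \<open>t\<close> never touches
  a tree of more than \<open>2 * t\<close> bits, and each instruction can be carried out by a Turing machine in time
  polynomial in its charge. Conversely, a Turing machine step is a constant number of instructions
  on a tree that holds the state and the two halves of the tape as lists. Hence polynomial time in
  this model is the usual polynomial time.
\<close>

datatype data = Leaf int | Node data data

text \<open>
  A leaf counts its binary digits and a sign bit.
\<close>

primrec data_size :: "data \<Rightarrow> nat" where
  "data_size (Leaf n) = Suc (floorlog 2 (nat \<bar>n\<bar>))"
| "data_size (Node a b) = Suc (data_size a + data_size b)"

datatype prog =
    Id
  | Const int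
  | Left
  | Right
  | IsLeaf
  | Add
  | Sub
  | Mul
  | Div
  | Leq
  | Fork prog prog
  | Seq prog prog
  | Cond prog prog prog
  | While prog prog

definition of_truth :: "bool \<Rightarrow> data" where
  "of_truth b = Leaf (if b then 1 else 0)"

text \<open>
  \<open>step P x y\<close> describes the atomic instructions. They are partial: \<^const>\<open>Left\<close> and \<^const>\<open>Right\<close> are
  stuck on a leaf, and the binary operations need a pair of leaves.
\<close>

inductive step :: "prog \<Rightarrow> data \<Rightarrow> data \<Rightarrow> bool" where
  "step Id x x"
| "step (Const n) x (Leaf n)"
| "step Left (Node a b) a"
| "step Right (Node a b) b"
| "step IsLeaf (Leaf n) (of_truth True)"
| "step IsLeaf (Node a b) (of_truth False)"
| "step Add (Node (Leaf m) (Leaf n)) (Leaf (m + n))"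
| "step Sub (Node (Leaf m) (Leaf n)) (Leaf (m - n))"
| "step Mul (Node (Leaf m) (Leaf n)) (Leaf (m * n))"
| "step Div (Node (Leaf m) (Leaf n)) (Leaf (m div n))"
| "step Leq (Node (Leaf m) (Leaf n)) (of_truth (m \<le> n))"

text \<open>
  \<open>exec P x y t\<close>: on input \<open>x\<close>, program \<open>P\<close> halts with output \<open>y\<close> at cost \<open>t\<close>. In tests, any result
  other than \<^term>\<open>Leaf 0\<close> counts as true.
\<close>

inductive exec :: "prog \<Rightarrow> data \<Rightarrow> data \<Rightarrow> nat \<Rightarrow> bool" where
  exec_step: "step P x y \<Longrightarrow> exec P x y (data_size x + data_size y)"
| exec_Fork: "exec P x y s \<Longrightarrow> exec Q x z t \<Longrightarrow>
    exec (Fork P Q) x (Node y z) (s + t + data_size x + data_size (Node y z))"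
| exec_Seq: "exec P x y s \<Longrightarrow> exec Q y z t \<Longrightarrow> exec (Seq P Q) x z (s + t + 1)"
| exec_Cond_true: "exec B x b s \<Longrightarrow> b \<noteq> Leaf 0 \<Longrightarrow> exec P x y t \<Longrightarrow>
    exec (Cond B P Q) x y (s + t + data_size x)"
| exec_Cond_false: "exec B x b s \<Longrightarrow> b = Leaf 0 \<Longrightarrow> exec Q x y t \<Longrightarrow>
    exec (Cond B P Q) x y (s + t + data_size x)"
| exec_While_false: "exec B x b s \<Longrightarrow> b = Leaf 0 \<Longrightarrow>
    exec (While B P) x x (s + data_size x)"
| exec_While_true: "exec B x b s \<Longrightarrow> b \<noteq> Leaf 0 \<Longrightarrow> exec P x y t \<Longrightarrow> exec (While B P) y z u \<Longrightarrow>
    exec (While B P) x z (s + t + u + data_size x)"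

inductive_cases step_cases [elim!]:
  "step Id x y" "step (Const n) x y" "step Left x y" "step Right x y" "step IsLeaf x y"
  "step Add x y" "step Sub x y" "step Mul x y" "step Div x y" "step Leq x y"
  "step (Fork P Q) x y" "step (Seq P Q) x y" "step (Cond B P Q) x y" "step (While B P) x y"

inductive_cases exec_cases:
  "exec (Fork P Q) x y t" "exec (Seq P Q) x y t" "exec (Cond B P Q) x y t" "exec (While B P) x y t"

lemma step_deterministic: "step P x y \<Longrightarrow> step P x y' \<Longrightarrow> y = y'"
  by (cases P) auto

lemma exec_deterministic: "exec P x y t \<Longrightarrow> exec P x y' t' \<Longrightarrow> y = y' \<and> t = t'"
proof (induction arbitrary: y' t' rule: exec.induct)
  case (exec_step P x y)
  from exec_step.prems exec_step.hyps show ?case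
    by (cases rule: exec.cases) (auto dest: step_deterministic)
next
  case (exec_Fork P x y s Q z t)
  from exec_Fork.prems show ?case
    by (rule exec_cases(1)) (use exec_Fork.hyps in \<open>auto dest!: exec_Fork.IH\<close>)
next
  case (exec_Seq P x y s Q z t)
  from exec_Seq.prems show ?case
    by (rule exec_cases(2)) (use exec_Seq.hyps in \<open>auto dest!: exec_Seq.IH\<close>)
next
  case (exec_Cond_true B x b s P y t Q)
  from exec_Cond_true.prems show ?case
    by (rule exec_cases(3)) (use exec_Cond_true.hyps in \<open>auto dest!: exec_Cond_true.IH\<close>)
next
  case (exec_Cond_false B x b s Q y t P)
  from exec_Cond_false.prems show ?case
    by (rule exec_cases(3)) (use exec_Cond_false.hyps in \<open>auto dest!: exec_Cond_false.IH\<close>)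
next
  case (exec_While_false B x b s P)
  from exec_While_false.prems show ?case
    by (rule exec_cases(4)) (use exec_While_false.hyps in \<open>auto dest!: exec_While_false.IH\<close>)
next
  case (exec_While_true B x b s P y t z u)
  from exec_While_true.prems show ?case
    by (rule exec_cases(4)) (use exec_While_true.hyps in \<open>auto dest!: exec_While_true.IH\<close>)
qed

lemma exec_data_size_le: "exec P x y t \<Longrightarrow> data_size x + data_size y \<le> 2 * t"
  by (induction rule: exec.induct) auto

text \<open>
  A search problem: for every admissible instance \<open>i \<in> I\<close>, given in the encoding \<open>enc\<close>, find some
  \<open>s\<close> with \<open>sol i s\<close> and output it in the encoding \<open>enc'\<close>. One program and one polynomial have to
  serve all instances.
\<close>

definition poly_time_solvable ::
    "'i set \<Rightarrow> ('i \<Rightarrow> data) \<Rightarrow> ('i \<Rightarrow> 's \<Rightarrow> bool) \<Rightarrow> ('s \<Rightarrow> data) \<Rightarrow> bool" where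
  "poly_time_solvable I enc sol enc' \<longleftrightarrow>
     (\<exists>(P :: prog) (p :: nat poly). \<forall>i\<in>I. \<exists>s t.
        exec P (enc i) (enc' s) t \<and> t \<le> poly p (data_size (enc i)) \<and> sol i s)"


section \<open>Encoding of instances with rational costs\<close>

text \<open>
  Vertices are natural numbers and sets are given by listing their elements without repetition,
  in an arbitrary order.
\<close>

record dst_input =
  vert_list :: "nat list"
  edge_list :: "(nat \<times> nat) list"
  cost_of :: "nat \<times> nat \<Rightarrow> rat"
  root_of :: nat
  term_list :: "nat list"

definition input_graph :: "dst_input \<Rightarrow> nat pair_pre_digraph" where
  "input_graph I = \<lparr>pverts = set (vert_list I), parcs = set (edge_list I)\<rparr>"

definition input_cost :: "dst_input \<Rightarrow> nat \<times> nat \<Rightarrow> real" where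
  "input_cost I e = real_of_rat (cost_of I e)"

definition input_terms :: "dst_input \<Rightarrow> nat set" where
  "input_terms I = set (term_list I)"

definition valid_input :: "dst_input \<Rightarrow> bool" where
  "valid_input I \<longleftrightarrow>
     distinct (vert_list I) \<and> distinct (edge_list I) \<and> distinct (term_list I) \<and>
     dst_instance (input_graph I) (input_cost I) (root_of I) (input_terms I)"

definition enc_nat :: "nat \<Rightarrow> data" where
  "enc_nat n = Leaf (int n)"

definition enc_rat :: "rat \<Rightarrow> data" where
  "enc_rat q = (case quotient_of q of (a, b) \<Rightarrow> Node (Leaf a) (Leaf b))"

definition enc_edge :: "nat \<times> nat \<Rightarrow> data" where
  "enc_edge e = Node (enc_nat (fst e)) (enc_nat (snd e))"

primrec enc_list :: "('b \<Rightarrow> data) \<Rightarrow> 'b list \<Rightarrow> data" where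
  "enc_list enc [] = Leaf 0"
| "enc_list enc (x # xs) = Node (enc x) (enc_list enc xs)"

definition enc_input :: "dst_input \<Rightarrow> data" where
  "enc_input I =
     Node (enc_list enc_nat (vert_list I))
    (Node (enc_list (\<lambda>e. Node (enc_edge e) (enc_rat (cost_of I e))) (edge_list I))
    (Node (enc_nat (root_of I))
          (enc_list enc_nat (term_list I))))"

end

theory Submission
  imports Defs "HOL-Real_Asymp.Real_Asymp"
begin

text \<open>
  Greedy merging. Partition the terminals into groups, each with a head that reaches the whole group
  through bought arcs; initially every terminal is its own head, and the root heads a group as well.
  A merge buys an arc \<open>(u, s)\<close> out of a terminal or the root together with shortest paths from \<open>s\<close> to a
  set \<open>J\<close> of other heads, and so puts the groups of \<open>J\<close> under the head of \<open>u\<close>. Buy a merge that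
  minimises \<open>\<rho> = cost / card J\<close>. If \<open>l\<close> heads other than the root remain, moats of width \<open>\<rho> / 2\<close> around all of
  them are a feasible dual solution, so \<open>l * \<rho> \<le> 2 * OPT\<close>, and the merges cost at most
  \<open>2 * OPT * (1 / k + \<dots> + 1 / 1)\<close> altogether.

  Shortest paths come from a Bellman-Ford table of explicit paths. Costs are made integral by a common
  denominator, which keeps all numbers polynomially long.
\<close>

section \<open>Functions computable in polynomial time\<close>

text \<open>Distances are always taken in the original graph: bought arcs keep their cost, so
  distances never change and only the set of heads shrinks. One distance table therefore serves all
  merges.

  Quasi-bipartiteness enters once: an arc into a Steiner node starts at a terminal or the root.
  Moats of different heads overlap at Steiner nodes only, because a terminal or root inside a
  foreign moat would start a merge of ratio below \<open>\<rho>\<close>. So every arc that is loaded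
  by several moats is itself the possible first arc of a merge, and the minimality of
  \<open>\<rho>\<close> controls its load. The factor 2 is the price of the moat of the tail's own
  head, which may load such an arc as well but belongs to no merge out of it.

  For a given arc the nearest heads are the cheapest ones, so distance thresholds replace the
  exponentially many choices of \<open>J\<close>. No LP is solved: the cost bound is proved against
  each feasible \<open>x\<close>, while the tree does not depend on \<open>x\<close>.\<close>

class encodable =
  fixes encode :: "'a \<Rightarrow> data"

instantiation int :: encodable
begin
definition encode_int_def [simp]: "encode (n :: int) = Leaf n"
instance ..
end

instantiation nat :: encodable
begin
definition encode_nat_def [simp]: "encode (n :: nat) = enc_nat n"
instance ..
end

instantiation bool :: encodable
begin
definition encode_bool_def [simp]: "encode b = of_truth b"
instance ..
end

instantiation prod :: (encodable, encodable) encodable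
begin
definition encode_prod_def [simp]: "encode z = Node (encode (fst z)) (encode (snd z))"
instance ..
end

instantiation list :: (encodable) encodable
begin
definition encode_list_def [simp]: "encode xs = enc_list encode xs"
instance ..
end

abbreviation sz :: "'a :: encodable \<Rightarrow> nat" where
  "sz x \<equiv> data_size (encode x)"

lemma data_size_pos [simp]: "0 < data_size d"
  by (cases d) auto

lemma sz_ge_1: "1 \<le> data_size d"
  using data_size_pos[of d] by linarith

lemma length_le_sz: "length xs \<le> sz xs"
  by (induction xs) auto

lemma sz_elem_le: "x \<in> set xs \<Longrightarrow> sz x \<le> sz xs"
  by (induction xs) auto

lemma sz_append: "sz (xs @ ys) + 1 = sz xs + sz ys"
  by (induction xs) (auto simp: floorlog_def)

lemma sz_list_le: "(\<And>x. x \<in> set xs \<Longrightarrow> sz x \<le> b) \<Longrightarrow> sz xs \<le> 1 + length xs * (b + 1)"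
proof (induction xs)
  case (Cons x xs)
  then have "sz x \<le> b" "sz xs \<le> 1 + length xs * (b + 1)"
    by auto
  then show ?case
    by (simp add: algebra_simps)
qed (simp add: floorlog_def)

section \<open>Polynomial bounds in the size of the encoded argument\<close>

lemma poly_nat_mono: "a \<le> b \<Longrightarrow> poly p a \<le> poly (p :: nat poly) b"
  by (induction p) (auto intro: add_mono mult_mono)

definition poly_bounded :: "('a :: encodable \<Rightarrow> nat) \<Rightarrow> bool" where
  "poly_bounded m \<longleftrightarrow> (\<exists>p. \<forall>x. m x \<le> poly p (sz x))"

lemma poly_bounded_le: "poly_bounded m \<Longrightarrow> (\<And>x. m' x \<le> m x) \<Longrightarrow> poly_bounded m'"
  unfolding poly_bounded_def by (meson order_trans)

named_theorems poly_bounded_intros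

lemma poly_bounded_const [poly_bounded_intros]: "poly_bounded (\<lambda>x. c)"
  unfolding poly_bounded_def by (intro exI[of _ "[:c:]"]) auto

lemma poly_bounded_sz_id: "poly_bounded (\<lambda>x. sz x)"
  unfolding poly_bounded_def by (intro exI[of _ "[:0, 1:]"]) auto

lemma poly_bounded_add [poly_bounded_intros]: "poly_bounded m \<Longrightarrow> poly_bounded m' \<Longrightarrow> poly_bounded (\<lambda>x. m x + m' x)"
  unfolding poly_bounded_def
proof (elim exE)
  fix p q assume "\<forall>x. m x \<le> poly p (sz x)" "\<forall>x. m' x \<le> poly q (sz x)"
  then show "\<exists>p. \<forall>x. m x + m' x \<le> poly p (sz x)"
    by (intro exI[of _ "p + q"]) (auto intro: add_mono)
qed

lemma poly_bounded_mult [poly_bounded_intros]: "poly_bounded m \<Longrightarrow> poly_bounded m' \<Longrightarrow> poly_bounded (\<lambda>x. m x * m' x)"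
  unfolding poly_bounded_def
proof (elim exE)
  fix p q assume "\<forall>x. m x \<le> poly p (sz x)" "\<forall>x. m' x \<le> poly q (sz x)"
  then show "\<exists>p. \<forall>x. m x * m' x \<le> poly p (sz x)"
    by (intro exI[of _ "p * q"]) (auto intro: mult_mono)
qed

lemma poly_bounded_poly: "poly_bounded m \<Longrightarrow> poly_bounded (\<lambda>x. poly p (m x))"
  unfolding poly_bounded_def
proof (elim exE)
  fix q assume "\<forall>x. m x \<le> poly q (sz x)"
  then show "\<exists>q. \<forall>x. poly p (m x) \<le> poly q (sz x)"
    by (intro exI[of _ "pcompose p q"]) (auto simp: poly_pcompose intro: poly_nat_mono)
qed

lemma poly_bounded_comp:
  assumes "poly_bounded m" "poly_bounded (\<lambda>x. sz (f x))"
  shows "poly_bounded (\<lambda>x. m (f x))"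
proof -
  obtain p where "\<forall>x. m x \<le> poly p (sz x)"
    using assms(1) unfolding poly_bounded_def by blast
  then show ?thesis
    by (intro poly_bounded_le[OF poly_bounded_poly[OF assms(2)]]) auto
qed

text \<open>Only upper bounds matter from here on; replacing the exact cost of \<open>exec\<close>
  by a bound allows costs to be enlarged to any convenient form.\<close>

definition runs :: "prog \<Rightarrow> data \<Rightarrow> data \<Rightarrow> nat \<Rightarrow> bool" where
  "runs P x y n \<longleftrightarrow> (\<exists>t\<le>n. exec P x y t)"

lemma runs_le: "runs P x y n \<Longrightarrow> n \<le> n' \<Longrightarrow> runs P x y n'"
  unfolding runs_def by (meson order_trans)

lemma runsI: "exec P x y t \<Longrightarrow> t \<le> n \<Longrightarrow> runs P x y n"
  unfolding runs_def by blast

lemma runsE: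
  assumes "runs P x y n"
  obtains t where "exec P x y t" "t \<le> n"
  using assms unfolding runs_def by blast

lemma runs_step: "step P x y \<Longrightarrow> runs P x y (data_size x + data_size y)"
  by (rule runsI[OF exec_step]) auto

lemma runs_Fork: "runs P x y s \<Longrightarrow> runs Q x z t \<Longrightarrow>
    runs (Fork P Q) x (Node y z) (s + t + data_size x + data_size (Node y z))"
  by (elim runsE) (rule runsI[OF exec_Fork], auto)

lemma runs_Seq: "runs P x y s \<Longrightarrow> runs Q y z t \<Longrightarrow> runs (Seq P Q) x z (s + t + 1)"
  by (elim runsE) (rule runsI[OF exec_Seq], auto)

lemma runs_Cond:
  assumes "runs B x (of_truth b) s" "runs (if b then P else Q) x y t"
  shows "runs (Cond B P Q) x y (s + t + data_size x)"
proof (cases b)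
  case True
  with assms show ?thesis
    by (elim runsE) (rule runsI[OF exec_Cond_true], auto simp: of_truth_def)
next
  case False
  with assms show ?thesis
    by (elim runsE) (rule runsI[OF exec_Cond_false], auto simp: of_truth_def)
qed

lemma runs_While_false: "runs B x (of_truth False) s \<Longrightarrow> runs (While B P) x x (s + data_size x)"
  by (elim runsE) (rule runsI[OF exec_While_false], auto simp: of_truth_def)

lemma runs_While_true: "runs B x (of_truth True) s \<Longrightarrow> runs P x y t \<Longrightarrow> runs (While B P) y z u \<Longrightarrow>
    runs (While B P) x z (s + t + u + data_size x)"
  by (elim runsE) (rule runsI[OF exec_While_true], auto simp: of_truth_def)

text \<open>
  Functions are total on the encodings of their argument type, so that closure rules need no domain
  conditions.
\<close>
definition poly_time :: "('a :: encodable \<Rightarrow> 'b :: encodable) \<Rightarrow> bool" where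
  "poly_time f \<longleftrightarrow> (\<exists>P m. poly_bounded m \<and> (\<forall>x. runs P (encode x) (encode (f x)) (m x)))"

lemma poly_timeI: "(\<And>x. runs P (encode x) (encode (f x)) (m x)) \<Longrightarrow> poly_bounded m \<Longrightarrow> poly_time f"
  unfolding poly_time_def by blast

lemma poly_timeE:
  assumes "poly_time f"
  obtains P m where "\<And>x. runs P (encode x) (encode (f x)) (m x)" "poly_bounded m"
  using assms unfolding poly_time_def by blast

lemma runs_sz: "runs P x y n \<Longrightarrow> data_size y \<le> 2 * n"
  unfolding runs_def using exec_data_size_le by fastforce

text \<open>A run pays for its output, so a time bound is also a bound on the output size. This is
  why composition needs no separate size hypothesis.\<close>

lemma poly_bounded_sz [poly_bounded_intros]:
  assumes "poly_time f"
  shows "poly_bounded (\<lambda>x. sz (f x))"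
proof -
  obtain P m where P: "\<And>x. runs P (encode x) (encode (f x)) (m x)" and m: "poly_bounded m"
    using assms by (rule poly_timeE) blast
  have "poly_bounded (\<lambda>x. 2 * m x)"
    by (intro poly_bounded_intros m)
  then show ?thesis
    by (rule poly_bounded_le) (use runs_sz[OF P] in auto)
qed

named_theorems poly_time_intros

lemma poly_time_comp:
  assumes "poly_time f" "poly_time g"
  shows "poly_time (\<lambda>x. f (g x))"
proof -
  obtain P m where P: "\<And>x. runs P (encode x) (encode (f x)) (m x)" "poly_bounded m"
    using assms(1) by (rule poly_timeE) blast
  obtain Q n where Q: "\<And>x. runs Q (encode x) (encode (g x)) (n x)" "poly_bounded n"
    using assms(2) by (rule poly_timeE) blast
  show ?thesis
    by (rule poly_timeI[OF runs_Seq[OF Q(1) P(1)]]) (intro poly_bounded_intros poly_bounded_comp[OF P(2)] Q(2) assms(2))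
qed

lemma poly_time_id [poly_time_intros]: "poly_time (\<lambda>x. x)"
  by (rule poly_timeI[OF runs_step[OF step.intros(1)]]) (intro poly_bounded_intros poly_bounded_sz_id)

lemma poly_time_pair [poly_time_intros]:
  assumes "poly_time f" "poly_time g"
  shows "poly_time (\<lambda>x. (f x, g x))"
proof -
  obtain P m where P: "\<And>x. runs P (encode x) (encode (f x)) (m x)" "poly_bounded m"
    using assms(1) by (rule poly_timeE) blast
  obtain Q n where Q: "\<And>x. runs Q (encode x) (encode (g x)) (n x)" "poly_bounded n"
    using assms(2) by (rule poly_timeE) blast
  have "runs (Fork P Q) (encode x) (encode (f x, g x)) (m x + n x + sz x + (1 + (sz (f x) + sz (g x))))" for x
    using runs_Fork[OF P(1)[of x] Q(1)[of x]] by simp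
  then show ?thesis
    by (rule poly_timeI) (intro poly_bounded_intros poly_bounded_sz_id P Q assms)
qed

lemma poly_time_fst [poly_time_intros]:
  fixes f :: "'a :: encodable \<Rightarrow> 'b :: encodable \<times> 'c :: encodable"
  assumes "poly_time f"
  shows "poly_time (\<lambda>x. fst (f x))"
proof (rule poly_time_comp[OF _ assms])
  have "runs Left (encode z) (encode (fst z)) (sz z + sz z)" for z :: "'b \<times> 'c"
    by (rule runs_le[OF runs_step]) (auto intro: step.intros)
  then show "poly_time (fst :: 'b \<times> 'c \<Rightarrow> 'b)"
    by (rule poly_timeI) (intro poly_bounded_intros poly_bounded_sz_id)
qed

lemma poly_time_snd [poly_time_intros]:
  fixes f :: "'a :: encodable \<Rightarrow> 'b :: encodable \<times> 'c :: encodable"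
  assumes "poly_time f"
  shows "poly_time (\<lambda>x. snd (f x))"
proof (rule poly_time_comp[OF _ assms])
  have "runs Right (encode z) (encode (snd z)) (sz z + sz z)" for z :: "'b \<times> 'c"
    by (rule runs_le[OF runs_step]) (auto intro: step.intros)
  then show "poly_time (snd :: 'b \<times> 'c \<Rightarrow> 'c)"
    by (rule poly_timeI) (intro poly_bounded_intros poly_bounded_sz_id)
qed

lemma poly_time_int_const: "poly_time (\<lambda>x :: 'a :: encodable. n :: int)"
proof -
  have "runs (Const n) (encode x) (encode n) (sz x + sz n)" for x :: 'a
    using runs_step[OF step.intros(2)] by simp
  then show ?thesis
    by (rule poly_timeI) (intro poly_bounded_intros poly_bounded_sz_id)
qed

text \<open>The result types of \<open>f\<close> and \<open>g\<close> may differ: only the data tree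
  counts. Thus a pair passes for a nonempty list and a natural number for an integer.\<close>

lemma poly_time_cong_encode:
  assumes "poly_time f" "\<And>x. encode (f x) = encode (g x)"
  shows "poly_time g"
  using assms unfolding poly_time_def by auto

text \<open>The induction is on the data tree, with one \<open>Const\<close> per leaf and one
  \<open>Fork\<close> per node, so constants of every encodable type are covered at once.\<close>

lemma poly_time_const_data: "\<exists>P m. poly_bounded m \<and> (\<forall>x :: 'a :: encodable. runs P (encode x) d (m x))"
proof (induction d)
  case (Leaf n)
  then show ?case
    using poly_time_int_const[of n, where 'a = 'a] unfolding poly_time_def by auto
next
  case (Node d d')
  then obtain P m Q n where
    P: "poly_bounded m" "\<And>x :: 'a. runs P (encode x) d (m x)" and
    Q: "poly_bounded n" "\<And>x :: 'a. runs Q (encode x) d' (n x)"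
    by blast
  have "poly_bounded (\<lambda>x. m x + n x + sz x + data_size (Node d d'))"
    by (intro poly_bounded_intros P Q poly_bounded_sz_id)
  then show ?case
    using runs_Fork[OF P(2) Q(2)] by blast
qed

lemma poly_time_const [poly_time_intros]: "poly_time (\<lambda>x. c)"
  using poly_time_const_data[of "encode c"] unfolding poly_time_def by blast

lemma poly_time_if [poly_time_intros]:
  assumes "poly_time b" "poly_time f" "poly_time g"
  shows "poly_time (\<lambda>x. if b x then f x else g x)"
proof -
  obtain B k where B: "\<And>x. runs B (encode x) (encode (b x)) (k x)" "poly_bounded k"
    using assms(1) by (rule poly_timeE) blast
  obtain P m where P: "\<And>x. runs P (encode x) (encode (f x)) (m x)" "poly_bounded m"
    using assms(2) by (rule poly_timeE) blast
  obtain Q n where Q: "\<And>x. runs Q (encode x) (encode (g x)) (n x)" "poly_bounded n"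
    using assms(3) by (rule poly_timeE) blast
  have "runs (Cond B P Q) (encode x) (encode (if b x then f x else g x)) (k x + (m x + n x) + sz x)" for x
    using P(1)[of x] Q(1)[of x] B(1)[of x] by (intro runs_Cond) (auto elim: runs_le)
  then show ?thesis
    by (rule poly_timeI) (intro poly_bounded_intros poly_bounded_sz_id B P Q)
qed

lemma poly_time_not [poly_time_intros]: "poly_time b \<Longrightarrow> poly_time (\<lambda>x. \<not> b x)"
  by (rule poly_time_cong_encode[OF poly_time_if[of b "\<lambda>x. False" "\<lambda>x. True"]]) (auto intro: poly_time_intros)

lemma poly_time_conj [poly_time_intros]: "poly_time a \<Longrightarrow> poly_time b \<Longrightarrow> poly_time (\<lambda>x. a x \<and> b x)"
  by (rule poly_time_cong_encode[OF poly_time_if[of a b "\<lambda>x. False"]]) (auto intro: poly_time_intros)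

lemma poly_time_int_step:
  assumes "\<And>m n. step I (Node (Leaf m) (Leaf n)) (encode (h m n))"
    and "\<And>m n. sz (h m n) \<le> sz m + sz n"
    and "poly_time f" "poly_time g"
  shows "poly_time (\<lambda>x. h (f x) (g x))"
proof -
  have "runs I (encode z) (encode (h (fst z) (snd z))) (2 * sz z)" for z
    using runs_step[OF assms(1)[of "fst z" "snd z"]] assms(2)[of "fst z" "snd z"]
    by (simp add: runs_le)
  then have "poly_time (\<lambda>z. h (fst z) (snd z))"
    by (rule poly_timeI) (intro poly_bounded_intros poly_bounded_sz_id)
  from poly_time_comp[OF this poly_time_pair[OF assms(3,4)]] show ?thesis
    by simp
qed

section \<open>Bit lengths of sums, products and quotients\<close>

lemma floorlog_2_le: "floorlog 2 n \<le> w \<longleftrightarrow> n < 2 ^ w"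
  by (simp add: floorlog_le_iff)

lemma sz_int_le: "sz (n :: int) \<le> Suc w \<longleftrightarrow> \<bar>n\<bar> < 2 ^ w"
  by (simp add: floorlog_2_le nat_less_iff)

lemma abs_less_power_sz: "\<bar>n :: int\<bar> < 2 ^ (sz n - 1)"
  using sz_int_le[of n "sz n - 1"] by simp

lemma sz_add_le: "sz (m + n :: int) \<le> sz m + sz n"
proof -
  have "\<bar>m\<bar> < 2 ^ (sz m - 1)" "\<bar>n\<bar> < 2 ^ (sz n - 1)"
    by (rule abs_less_power_sz)+
  moreover have "2 ^ (sz m - 1) \<le> (2 ^ (sz m + sz n - 2) :: int)" "2 ^ (sz n - 1) \<le> (2 ^ (sz m + sz n - 2) :: int)"
    by (intro power_increasing; simp)+
  ultimately have "\<bar>m + n\<bar> < 2 ^ (sz m + sz n - 2) + 2 ^ (sz m + sz n - 2)"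
    by linarith
  also have "\<dots> = 2 ^ (sz m + sz n - 1)"
    by (simp flip: power_Suc mult_2)
  finally show ?thesis
    using sz_int_le[of "m + n" "sz m + sz n - 1"] by simp
qed

lemma sz_mult_le: "sz (m * n :: int) \<le> sz m + sz n"
proof -
  have "\<bar>m * n\<bar> < 2 ^ (sz m - 1) * 2 ^ (sz n - 1)"
    unfolding abs_mult using abs_less_power_sz[of m] abs_less_power_sz[of n] by (intro mult_strict_mono) auto
  also have "\<dots> = 2 ^ (sz m + sz n - 2)"
    by (simp flip: power_add)
  finally show ?thesis
    using sz_int_le[of "m * n" "sz m + sz n - 2"] by simp
qed

text \<open>A negative divisor is removed by negating both arguments; a zero divisor gives the
  quotient 0.\<close>

lemma abs_div_le: "\<bar>m div n\<bar> \<le> \<bar>m :: int\<bar>"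
proof -
  have *: "\<bar>m div n\<bar> \<le> \<bar>m\<bar>" if "0 < n" for m n :: int
  proof (cases "0 \<le> m")
    case True
    then show ?thesis
      using that zdiv_mono2[of m 1 n] by (simp add: pos_imp_zdiv_nonneg_iff)
  next
    case False
    then show ?thesis
      using that zdiv_mono2_neg[of m 1 n] pos_imp_zdiv_neg_iff[of n m] by simp
  qed
  show ?thesis
    using *[of n m] *[of "- n" "- m"] by (cases n "0 :: int" rule: linorder_cases) auto
qed

lemma sz_div_le: "sz (m div n :: int) \<le> sz m + sz n"
proof -
  have "\<bar>m div n\<bar> < 2 ^ (sz m - 1)"
    using abs_div_le abs_less_power_sz by (rule le_less_trans)
  then show ?thesis
    using sz_int_le[of "m div n" "sz m - 1"] by simp
qed

lemma poly_time_add [poly_time_intros]: "poly_time f \<Longrightarrow> poly_time g \<Longrightarrow> poly_time (\<lambda>x. f x + g x :: int)"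
  by (rule poly_time_int_step[where I = Add and h = "(+)"]) (use sz_add_le in \<open>auto intro: step.intros simp del: data_size.simps\<close>)

lemma poly_time_mult [poly_time_intros]: "poly_time f \<Longrightarrow> poly_time g \<Longrightarrow> poly_time (\<lambda>x. f x * g x :: int)"
  by (rule poly_time_int_step[where I = Mul and h = "(*)"]) (use sz_mult_le in \<open>auto intro: step.intros simp del: data_size.simps\<close>)

lemma poly_time_div [poly_time_intros]: "poly_time f \<Longrightarrow> poly_time g \<Longrightarrow> poly_time (\<lambda>x. f x div g x :: int)"
  by (rule poly_time_int_step[where I = Div and h = "(div)"]) (use sz_div_le in \<open>auto intro: step.intros simp del: data_size.simps\<close>)

lemma poly_time_le_int [poly_time_intros]:
  assumes "poly_time f" "poly_time g"
  shows "poly_time (\<lambda>x. (f x :: int) \<le> g x)"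
proof (rule poly_time_int_step[where h = "(\<le>)", OF _ _ assms])
  show "step Leq (Node (Leaf m) (Leaf n)) (encode (m \<le> n))" for m n
    unfolding encode_bool_def by (rule step.intros)
  show "sz (m \<le> n) \<le> sz m + sz n" for m n :: int
    by (auto simp: of_truth_def floorlog_def)
qed

lemma poly_time_less_int [poly_time_intros]: "poly_time f \<Longrightarrow> poly_time g \<Longrightarrow> poly_time (\<lambda>x. (f x :: int) < g x)"
  unfolding not_le[symmetric] by (intro poly_time_intros)

lemma poly_time_of_nat: "poly_time f \<Longrightarrow> poly_time (\<lambda>x. int (f x))"
  by (erule poly_time_cong_encode) (simp add: enc_nat_def)

lemma poly_time_eq_nat [poly_time_intros]:
  assumes "poly_time f" "poly_time g"
  shows "poly_time (\<lambda>x. (f x :: nat) = g x)"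
proof -
  have *: "(f x = g x) = (int (f x) \<le> int (g x) \<and> int (g x) \<le> int (f x))" for x
    by auto
  show ?thesis
    unfolding * by (intro poly_time_intros poly_time_of_nat assms)
qed


section \<open>Lists: tests, loops and folds\<close>

lemma poly_time_Cons [poly_time_intros]:
  assumes "poly_time f" "poly_time g"
  shows "poly_time (\<lambda>x. f x # g x)"
  by (rule poly_time_cong_encode[OF poly_time_pair[OF assms]]) simp

lemma poly_time_null [poly_time_intros]:
  fixes l :: "'a :: encodable \<Rightarrow> 'b :: encodable list"
  assumes "poly_time l"
  shows "poly_time (\<lambda>x. l x = [])"
proof (rule poly_time_comp[OF _ assms])
  have "runs IsLeaf (encode xs) (encode (xs = [])) (sz xs + 3)" for xs :: "'b list"
  proof -
    have "step IsLeaf (encode xs) (encode (xs = []))"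
      by (cases xs; simp; rule step.intros)
    then show ?thesis
      by (rule runs_le[OF runs_step]) (auto simp: of_truth_def floorlog_def)
  qed
  then show "poly_time (\<lambda>xs :: 'b list. xs = [])"
    by (rule poly_timeI) (intro poly_bounded_intros poly_bounded_sz_id)
qed

text \<open>The loop state consists of an environment \<open>x\<close>, the entries still to be
  visited and an accumulator. \<open>IsLeaf\<close> recognises the empty list, but a loop runs while
  its test is true, so the \<open>Cond\<close> negates the answer.\<close>

lemma runs_nonempty_test:
  assumes "b = (ys \<noteq> [])"
  shows "runs (Cond (Seq (Seq Right Left) IsLeaf) (Const 0) (Const 1)) (Node x (Node (encode ys) z))
    (of_truth b) (10 * data_size (Node x (Node (encode ys) z)))"
proof -
  let ?s = "Node x (Node (encode ys) z)"
  have "runs (Seq (Seq Right Left) IsLeaf) ?s (of_truth (ys = []))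
     (data_size ?s + data_size (Node (encode ys) z) + (data_size (Node (encode ys) z) + sz ys) + 1
       + (sz ys + data_size (of_truth (ys = []))) + 1)"
    by (rule runs_Seq[OF runs_Seq[OF runs_step[OF step.intros(4)] runs_step[OF step.intros(3)]] runs_step])
      (cases ys; simp; rule step.intros)
  moreover have "runs (if ys = [] then Const 0 else Const 1) ?s (of_truth (ys \<noteq> [])) (data_size ?s + 2)"
    by (cases "ys = []"; simp add: of_truth_def; rule runs_le[OF runs_step[OF step.intros(2)]]) (auto simp: floorlog_def)
  ultimately show ?thesis
    unfolding assms by (rule runs_le[OF runs_Cond]) (use sz_ge_1[of x] sz_ge_1[of z] sz_ge_1[of "encode ys"] in
      \<open>auto simp: of_truth_def floorlog_def\<close>)
qed

text \<open>\<open>B\<close> bounds the accumulator after every prefix, not only at the end, because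
  each iteration is charged for the whole state. The count \<open>length ys + 1\<close> includes the
  final failing test.\<close>

lemma runs_loop:
  fixes x :: "'a :: encodable" and ys :: "'b :: encodable list" and acc :: "'c :: encodable"
  assumes body: "\<And>y ys acc. runs body (Node (encode x) (Node (encode (y # ys)) (encode acc)))
      (Node (encode x) (Node (encode ys) (encode (g y acc)))) (m (sz (y # ys) + sz acc))"
    and m: "\<And>a b. a \<le> b \<Longrightarrow> m a \<le> m b"
    and B: "\<And>n. n \<le> length ys \<Longrightarrow> sz (fold g (take n ys) acc) \<le> B"
    and L: "sz ys \<le> L"
  shows "runs (While (Cond (Seq (Seq Right Left) IsLeaf) (Const 0) (Const 1)) body)
      (Node (encode x) (Node (encode ys) (encode acc)))
      (Node (encode x) (Node (encode ([] :: 'b list)) (encode (fold g ys acc))))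
      ((length ys + 1) * (11 * (sz x + L + B + 2) + m (L + B)))"
  using B L
proof (induction ys arbitrary: acc)
  case Nil
  have "runs (Cond (Seq (Seq Right Left) IsLeaf) (Const 0) (Const 1))
      (Node (encode x) (Node (encode ([] :: 'b list)) (encode acc))) (of_truth False) (10 * (sz x + L + B + 2))"
    by (rule runs_le[OF runs_nonempty_test]) (use Nil.prems(1)[of 0] Nil.prems(2) in auto)
  then show ?case
    unfolding fold_simps by (rule runs_le[OF runs_While_false]) (use Nil.prems(1)[of 0] Nil.prems(2) in auto)
next
  case (Cons a ys)
  have B0: "sz acc \<le> B"
    using Cons.prems(1)[of 0] by simp
  have "runs (While (Cond (Seq (Seq Right Left) IsLeaf) (Const 0) (Const 1)) body)
      (Node (encode x) (Node (encode ys) (encode (g a acc))))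
      (Node (encode x) (Node (encode ([] :: 'b list)) (encode (fold g ys (g a acc)))))
      ((length ys + 1) * (11 * (sz x + L + B + 2) + m (L + B)))"
  proof (rule Cons.IH)
    show "sz (fold g (take n ys) (g a acc)) \<le> B" if "n \<le> length ys" for n
      using Cons.prems(1)[of "Suc n"] that by simp
    show "sz ys \<le> L"
      using Cons.prems(2) by simp
  qed
  moreover have "runs (Cond (Seq (Seq Right Left) IsLeaf) (Const 0) (Const 1))
      (Node (encode x) (Node (encode (a # ys)) (encode acc))) (of_truth True) (10 * (sz x + L + B + 2))"
    by (rule runs_le[OF runs_nonempty_test]) (use B0 Cons.prems(2) in auto)
  moreover have "runs body (Node (encode x) (Node (encode (a # ys)) (encode acc)))
      (Node (encode x) (Node (encode ys) (encode (g a acc)))) (m (L + B))"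
    by (rule runs_le[OF body]) (use B0 Cons.prems(2) in \<open>auto intro!: m\<close>)
  ultimately show ?case
    using B0 Cons.prems(2) by (auto intro: runs_le[OF runs_While_true] simp: algebra_simps)
qed

text \<open>
  The size of the accumulator must be bounded separately: iterating a polynomial-time function can
  double it in every step.
\<close>
lemma poly_time_fold:
  assumes l: "poly_time l" and a: "poly_time a"
    and g: "poly_time (\<lambda>z. g (fst z) (fst (snd z)) (snd (snd z)))"
    and B: "poly_bounded B"
    and le: "\<And>x n. n \<le> length (l x) \<Longrightarrow> sz (fold (g x) (take n (l x)) (a x)) \<le> B x"
  shows "poly_time (\<lambda>x. fold (g x) (l x) (a x))"
proof -
  obtain G m where G: "\<And>z. runs G (encode z) (encode (g (fst z) (fst (snd z)) (snd (snd z)))) (m z)"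
    and "poly_bounded m"
    using g by (rule poly_timeE) blast
  then obtain p where p: "\<And>z. m z \<le> poly p (sz z)"
    unfolding poly_bounded_def by blast
  \<comment> \<open>One pass keeps the environment, drops the first entry and hands environment,
    entry and accumulator to \<open>G\<close>.\<close>
  define body where "body = Fork Left (Fork (Seq (Seq Right Left) Right)
    (Seq (Fork Left (Fork (Seq (Seq Right Left) Left) (Seq Right Right))) G))"
  have G': "runs G (Node x (Node y acc)) z (poly p (data_size x + data_size y + data_size acc + 2))"
    if "x = encode x'" "y = encode y'" "acc = encode acc'" "z = encode (g x' y' acc')" for x y acc z x' y' acc'
    using runs_le[OF G p[of "(x', y', acc')"]] that by (simp add: ac_simps)
  \<comment> \<open>The factor 5: one run of \<open>G\<close>, and its output, of size at most twice
    that cost, written again by each of the two enclosing \<open>Fork\<close> instructions.\<close>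
  have body: "runs body (Node (encode x) (Node (encode (y # ys)) (encode acc)))
      (Node (encode x) (Node (encode ys) (encode (g x y acc))))
      (5 * poly p (sz x + (sz (y # ys) + sz acc) + 2) + 60 * (sz x + (sz (y # ys) + sz acc) + 2))"
    (is "runs _ ?s _ (5 * poly p ?n + 60 * ?n)") for x y ys acc
  proof -
    have Y: "encode (y # ys) = Node (encode y) (encode ys)"
      by simp
    have n: "data_size ?s = ?n" "sz (y # ys) = Suc (sz y + sz ys)"
      by simp_all
    note RL = runs_Seq[OF runs_step[OF step.intros(4)] runs_step[OF step.intros(3)]]
    have 1: "runs (Seq (Seq Right Left) Right) ?s (encode ys) (10 * ?n)"
      unfolding Y by (rule runs_le[OF runs_Seq[OF RL runs_step[OF step.intros(4)]]]) auto
    have 2: "runs (Seq (Seq Right Left) Left) ?s (encode y) (10 * ?n)"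
      unfolding Y by (rule runs_le[OF runs_Seq[OF RL runs_step[OF step.intros(3)]]]) auto
    have 3: "runs (Seq Right Right) ?s (encode acc) (10 * ?n)"
      by (rule runs_le[OF runs_Seq[OF runs_step[OF step.intros(4)] runs_step[OF step.intros(4)]]]) auto
    have 4: "runs Left ?s (encode x) (2 * ?n)"
      by (rule runs_le[OF runs_step[OF step.intros(3)]]) auto
    have "poly p (sz x + sz y + sz acc + 2) \<le> poly p ?n"
      by (rule poly_nat_mono) auto
    then have 5: "runs G (Node (encode x) (Node (encode y) (encode acc))) (encode (g x y acc)) (poly p ?n)"
      by (rule runs_le[OF G'[OF refl refl refl refl]])
    then have 6: "sz (g x y acc) \<le> 2 * poly p ?n"
      by (rule runs_sz)
    show ?thesis
      unfolding body_def
      by (rule runs_le[OF runs_Fork[OF 4 runs_Fork[OF 1 runs_Seq[OF runs_Fork[OF 4 runs_Fork[OF 2 3]] 5]]]])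
         (use 6 in \<open>simp add: n\<close>)
  qed
  define loop where "loop = While (Cond (Seq (Seq Right Left) IsLeaf) (Const 0) (Const 1)) body"
  define T where "T x = (sz (l x) + 1) * (11 * (sz x + sz (l x) + B x + 2)
    + (5 * poly p (sz x + (sz (l x) + B x) + 2) + 60 * (sz x + (sz (l x) + B x) + 2)))" for x
  have loop: "runs loop (encode (x, l x, a x)) (encode (x, [] :: 'b list, fold (g x) (l x) (a x))) (T x)" for x
  proof -
    have mono: "5 * poly p (sz x + i + 2) + 60 * (sz x + i + 2) \<le> 5 * poly p (sz x + j + 2) + 60 * (sz x + j + 2)"
      if "i \<le> j" for i j
      using that by (intro add_mono mult_le_mono poly_nat_mono) auto
    have "runs loop (encode (x, l x, a x)) (encode (x, [] :: 'b list, fold (g x) (l x) (a x)))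
      ((length (l x) + 1) * (11 * (sz x + sz (l x) + B x + 2)
        + (5 * poly p (sz x + (sz (l x) + B x) + 2) + 60 * (sz x + (sz (l x) + B x) + 2))))"
      unfolding loop_def encode_prod_def fst_conv snd_conv
      by (rule runs_loop[where g = "g x" and m = "\<lambda>n. 5 * poly p (sz x + n + 2) + 60 * (sz x + n + 2)"
          and ys = "l x" and L = "sz (l x)" and B = "B x" and acc = "a x", OF body mono le[of _ x] order_refl])
    then show ?thesis
      unfolding T_def by (rule runs_le) (intro mult_le_mono1 add_right_mono length_le_sz)
  qed
  have "poly_time (\<lambda>x. (x, l x, a x))"
    by (intro poly_time_intros l a)
  then obtain I k where I: "\<And>x. runs I (encode x) (encode (x, l x, a x)) (k x)" "poly_bounded k"
    by (rule poly_timeE) blast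
  have out: "runs (Seq Right Right) (encode (x, [] :: 'b list, z)) (encode z) (5 * (sz x + sz z + 3))" for x z
    by (rule runs_le[OF runs_Seq[OF runs_step runs_step]]) (auto intro: step.intros simp: floorlog_def)
  have "poly_bounded T"
    unfolding T_def by (intro poly_bounded_intros poly_bounded_poly poly_bounded_sz_id B l)
  have "runs (Seq (Seq I loop) (Seq Right Right)) (encode x) (encode (fold (g x) (l x) (a x)))
      (k x + T x + 5 * (sz x + B x + 3) + 2)" for x
    by (rule runs_le[OF runs_Seq[OF runs_Seq[OF I(1) loop] out]]) (use le[of "length (l x)" x] in simp)
  then show ?thesis
    by (rule poly_timeI) (intro poly_bounded_intros poly_bounded_sz_id B I \<open>poly_bounded T\<close>)
qed

section \<open>Lists in polynomial time\<close>

text \<open>Pushing entries onto an accumulator only moves them, so the total size stays bounded;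
  reversal and concatenation are both instances.\<close>

lemma poly_time_fold_append:
  assumes "poly_time l" "poly_time a"
  shows "poly_time (\<lambda>x. rev (l x) @ a x)"
proof -
  have *: "fold (#) xs ys = rev xs @ ys" for xs ys :: "'b list"
    by (induction xs arbitrary: ys) auto
  have len: "sz xs = sz ys" if "mset xs = mset ys" for xs ys :: "'b list"
  proof -
    have "sz zs = 1 + sum_mset (image_mset (\<lambda>z. 1 + sz z) (mset zs))" for zs :: "'b list"
      by (induction zs) (auto simp: floorlog_def)
    then show ?thesis
      using that by metis
  qed
  have "sz (fold (#) (take n (l x)) (a x)) \<le> sz (l x) + sz (a x)" for n x
  proof -
    have "sz (rev (take n (l x)) @ a x) + 1 = sz (take n (l x)) + sz (a x)"
      using sz_append[of "rev (take n (l x))" "a x"] len[of "rev (take n (l x))" "take n (l x)"] by simp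
    moreover have "sz (take n (l x)) + sz (drop n (l x)) = sz (l x) + 1"
      using sz_append[of "take n (l x)" "drop n (l x)"] by simp
    ultimately show ?thesis
      unfolding * using sz_ge_1[of "encode (drop n (l x))"] by linarith
  qed
  then have "poly_time (\<lambda>x. fold (#) (l x) (a x))"
    by (intro poly_time_fold[where B = "\<lambda>x. sz (l x) + sz (a x)"] poly_time_intros poly_bounded_intros assms)
  then show ?thesis
    unfolding * .
qed

lemma poly_time_rev [poly_time_intros]: "poly_time l \<Longrightarrow> poly_time (\<lambda>x. rev (l x))"
  using poly_time_fold_append[of l "\<lambda>x. []"] by (simp add: poly_time_const)

lemma poly_time_append [poly_time_intros]: "poly_time l \<Longrightarrow> poly_time a \<Longrightarrow> poly_time (\<lambda>x. l x @ a x)"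
  using poly_time_fold_append[of "\<lambda>x. rev (l x)" a] by (simp add: poly_time_rev)

lemma sz_take_le: "sz (take n xs) \<le> sz xs"
  using sz_append[of "take n xs" "drop n xs"] sz_ge_1[of "encode (drop n xs)"] unfolding append_take_drop_id by linarith

text \<open>The general traversal: maps, filters and bounded quantifiers follow by choosing
  \<open>f\<close>. The accumulator is the concatenation over the visited prefix, whose size is
  bounded by the number of entries times a bound for a single value of \<open>f\<close>.\<close>

lemma poly_time_concat_map [poly_time_intros]:
  assumes l: "poly_time l" and f: "poly_time (\<lambda>z. f (fst z) (snd z))"
  shows "poly_time (\<lambda>x. concat (map (f x) (l x)))"
proof -
  have *: "fold (\<lambda>y acc. acc @ f x y) ys acc = acc @ concat (map (f x) ys)" for x ys acc
    by (induction ys arbitrary: acc) auto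
  obtain p where p: "\<And>z. sz (f (fst z) (snd z)) \<le> poly p (sz z)"
    using poly_bounded_sz[OF f] unfolding poly_bounded_def by blast
  have f_le: "sz (f x y) \<le> poly p (sz x + sz (l x) + 1)" if "y \<in> set (l x)" for x y
    using p[of "(x, y)"] sz_elem_le[OF that]
    by (auto intro: order_trans[OF _ poly_nat_mono])
  have concat_le: "sz (concat zs) \<le> 1 + length zs * b" if "\<And>z. z \<in> set zs \<Longrightarrow> sz z \<le> b" for zs :: "'c list list" and b
    using that
  proof (induction zs)
    case (Cons z zs)
    then have "sz z \<le> b" "sz (concat zs) \<le> 1 + length zs * b"
      by auto
    then show ?case
      using sz_append[of z "concat zs"] by simp
  qed (simp add: floorlog_def)
  define B where "B x = 1 + sz (l x) * poly p (sz x + sz (l x) + 1)" for x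
  have "sz (fold (\<lambda>y acc. acc @ f x y) (take n (l x)) []) \<le> B x" for x n
  proof -
    have "sz (concat (map (f x) (take n (l x)))) \<le> 1 + length (map (f x) (take n (l x))) * poly p (sz x + sz (l x) + 1)"
      using f_le in_set_takeD by (intro concat_le) fastforce
    also have "\<dots> \<le> B x"
      using length_le_sz[of "l x"] unfolding B_def by (intro add_left_mono mult_le_mono1) auto
    finally show ?thesis
      unfolding * by simp
  qed
  moreover have "poly_bounded B"
    unfolding B_def by (intro poly_bounded_intros poly_bounded_poly poly_bounded_sz_id l)
  moreover have "poly_time (\<lambda>z. f (fst z) (fst (snd z)))"
    using poly_time_comp[OF f, of "\<lambda>z. (fst z, fst (snd z))"] by (simp add: poly_time_intros)
  ultimately have "poly_time (\<lambda>x. fold (\<lambda>y acc. acc @ f x y) (l x) [])"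
    by (intro poly_time_fold[where B = B] l poly_time_intros)
  then show ?thesis
    unfolding * by simp
qed

lemma poly_time_map [poly_time_intros]:
  assumes "poly_time l" "poly_time (\<lambda>z. f (fst z) (snd z))"
  shows "poly_time (\<lambda>x. map (f x) (l x))"
proof -
  have "map (f x) xs = concat (map (\<lambda>y. [f x y]) xs)" for x xs
    by (induction xs) auto
  then show ?thesis
    by (simp only:) (intro poly_time_intros assms)
qed

lemma poly_time_filter [poly_time_intros]:
  assumes "poly_time l" "poly_time (\<lambda>z. f (fst z) (snd z))"
  shows "poly_time (\<lambda>x. filter (f x) (l x))"
proof -
  have "filter (f x) xs = concat (map (\<lambda>y. if f x y then [y] else []) xs)" for x xs
    by (induction xs) auto
  then show ?thesis
    by (simp only:) (intro poly_time_intros assms)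
qed

lemma poly_time_Bex [poly_time_intros]:
  assumes "poly_time l" "poly_time (\<lambda>z. f (fst z) (snd z))"
  shows "poly_time (\<lambda>x. \<exists>y\<in>set (l x). f x y)"
proof -
  have "(\<exists>y\<in>set xs. f x y) = (\<not> filter (f x) xs = [])" for x xs
    by (auto simp: filter_empty_conv)
  then show ?thesis
    by (simp only:) (intro poly_time_intros assms)
qed

lemma poly_time_Ball [poly_time_intros]:
  assumes "poly_time l" "poly_time (\<lambda>z. f (fst z) (snd z))"
  shows "poly_time (\<lambda>x. \<forall>y\<in>set (l x). f x y)"
proof -
  have "(\<forall>y\<in>set xs. f x y) = (\<not> (\<exists>y\<in>set xs. \<not> f x y))" for x xs
    by auto
  then show ?thesis
    by (simp only:) (intro poly_time_intros assms)
qed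

lemma poly_time_mem_nat [poly_time_intros]:
  assumes "poly_time l" "poly_time a"
  shows "poly_time (\<lambda>x. (a x :: nat) \<in> set (l x))"
proof -
  have "a x \<in> set (l x) \<longleftrightarrow> (\<exists>y\<in>set (l x). y = a x)" for x
    by auto
  moreover have "poly_time (\<lambda>z. a (fst z))"
    by (rule poly_time_comp[OF assms(2)]) (intro poly_time_intros)
  ultimately show ?thesis
    by (simp only:) (intro poly_time_intros assms)
qed

lemma poly_time_sum_list [poly_time_intros]:
  fixes l :: "'a :: encodable \<Rightarrow> int list"
  assumes "poly_time l"
  shows "poly_time (\<lambda>x. sum_list (l x))"
proof -
  have *: "fold (+) xs a = sum_list xs + a" for xs and a :: int
    by (induction xs arbitrary: a) auto
  have "sz (sum_list xs) \<le> sz xs" for xs :: "int list"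
  proof (induction xs)
    case (Cons y ys)
    then show ?case
      using sz_add_le[of y "sum_list ys"] by simp
  qed simp
  then have "sz (fold (+) (take n (l x)) 0) \<le> sz (l x)" for n x
    unfolding * using sz_take_le le_trans by (metis add_0_right)
  then have "poly_time (\<lambda>x. fold (+) (l x) 0)"
    by (intro poly_time_fold[where B = "\<lambda>x. sz (l x)"] poly_time_intros poly_bounded_intros assms)
  then show ?thesis
    unfolding * by simp
qed

lemma poly_time_prod_list [poly_time_intros]:
  fixes l :: "'a :: encodable \<Rightarrow> int list"
  assumes "poly_time l"
  shows "poly_time (\<lambda>x. prod_list (l x))"
proof -
  have *: "fold (*) xs a = prod_list xs * a" for xs and a :: int
    by (induction xs arbitrary: a) auto
  \<comment> \<open>The extra unit is due to the starting value 1, whose size exceeds that of the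
    empty list by one.\<close>
  have "sz (prod_list xs) \<le> 1 + sz xs" for xs :: "int list"
  proof (induction xs)
    case (Cons y ys)
    then show ?case
      using sz_mult_le[of y "prod_list ys"] by simp
  qed (simp add: floorlog_def)
  then have "sz (fold (*) (take n (l x)) 1) \<le> 1 + sz (l x)" for n x
    unfolding * using sz_take_le[of n "l x"] le_trans add_left_mono by (metis mult_1_right)
  then have "poly_time (\<lambda>x. fold (*) (l x) 1)"
    by (intro poly_time_fold[where B = "\<lambda>x. 1 + sz (l x)"] poly_time_intros poly_bounded_intros assms)
  then show ?thesis
    unfolding * by simp
qed

text \<open>The result has at most one entry and plays the role of an option, so an empty list of
  candidates needs no default value.\<close>

definition pick :: "('a \<Rightarrow> 'a \<Rightarrow> bool) \<Rightarrow> 'a list \<Rightarrow> 'a list" where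
  "pick lt xs = fold (\<lambda>y acc. if \<forall>z\<in>set acc. lt y z then [y] else acc) xs []"

lemma pick_snoc: "pick lt (xs @ [y]) = (if \<forall>z\<in>set (pick lt xs). lt y z then [y] else pick lt xs)"
  by (simp add: pick_def)

lemma pick_cases: "(xs = [] \<and> pick lt xs = []) \<or> (\<exists>z\<in>set xs. pick lt xs = [z])"
proof (induction xs rule: rev_induct)
  case Nil
  then show ?case
    by (simp add: pick_def)
qed (auto simp: pick_snoc)

text \<open>
  The order condition is relative to \<open>A\<close> because \<open>cheaper\<close> below cross-multiplies ratios, which is
  transitive only where the denominators are positive.
\<close>
lemma pick_minimal:
  assumes "\<And>a b c. a \<in> A \<Longrightarrow> b \<in> A \<Longrightarrow> c \<in> A \<Longrightarrow> \<not> lt a b \<Longrightarrow> lt c b \<Longrightarrow> \<not> lt a c"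
    and "\<And>a. \<not> lt a a"
  shows "set xs \<subseteq> A \<Longrightarrow> pick lt xs = [z] \<Longrightarrow> y \<in> set xs \<Longrightarrow> \<not> lt y z"
proof (induction xs arbitrary: y z rule: rev_induct)
  case (snoc x xs)
  show ?case
  proof (cases "xs = []")
    case True
    then show ?thesis
      using snoc.prems assms(2) by (auto simp: pick_def)
  next
    case False
    then obtain w where w: "w \<in> set xs" "pick lt xs = [w]"
      using pick_cases[of xs lt] by auto
    have IH: "\<not> lt y' w" if "y' \<in> set xs" for y'
      using snoc.IH[OF _ w(2) that] snoc.prems(1) by auto
    show ?thesis
    proof (cases "lt x w")
      case True
      then have "z = x"
        using snoc.prems w by (auto simp: pick_snoc)
      then show ?thesis
        using IH snoc.prems(1,3) assms(1)[of y w x] assms(2)[of x] True w(1) by auto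
    next
      case False
      then show ?thesis
        using IH snoc.prems w by (auto simp: pick_snoc)
    qed
  qed
qed simp

lemma poly_time_pick [poly_time_intros]:
  assumes "poly_time l" "poly_time (\<lambda>z. lt (fst z) (fst (snd z)) (snd (snd z)))"
  shows "poly_time (\<lambda>x. pick (lt x) (l x))"
  unfolding pick_def
proof (rule poly_time_fold)
  show "poly_time (\<lambda>z. if \<forall>w\<in>set (snd (snd z)). lt (fst z) (fst (snd z)) w then [fst (snd z)] else snd (snd z))"
    using poly_time_comp[OF assms(2), of "\<lambda>z. (fst (fst z), fst (snd (fst z)), snd z)"]
    by (intro poly_time_intros) (simp add: poly_time_intros)
  show "poly_bounded (\<lambda>x. 2 + sz (l x))"
    by (intro poly_bounded_intros assms)
  show "sz (fold (\<lambda>y acc. if \<forall>w\<in>set acc. lt x y w then [y] else acc) (take n (l x)) []) \<le> 2 + sz (l x)" for n x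
    using pick_cases[of "take n (l x)" "lt x"] sz_elem_le[of _ "l x"]
    unfolding pick_def[symmetric] by (auto simp: floorlog_def dest!: in_set_takeD)
qed (intro poly_time_intros assms)+

section \<open>The linear programming bound on the density\<close>

text \<open>Slice \<open>\<pi>\<close> into levels: the vertices of potential at most a given level,
  taken from \<open>\<pi> j\<close> up to but excluding \<open>\<pi> r\<close>, contain
  \<open>j\<close> and not \<open>r\<close>, so the LP puts weight at least 1 on the arcs entering
  them. This is weak duality with the gaps between consecutive values as dual variables; the
  induction removes the lowest gap.\<close>

lemma lp_potential:
  fixes \<pi> :: "'a \<Rightarrow> real"
  assumes "dst_instance G c r X" "lp_feasible G r X x" "j \<in> X"
  shows "\<pi> r - \<pi> j \<le> (\<Sum>e\<in>parcs G. x e * max 0 (\<pi> (fst e) - \<pi> (snd e)))"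
proof (induction "card (\<pi> ` pverts G)" arbitrary: \<pi> rule: less_induct)
  case less
  interpret dst_instance G c r X by fact
  have x: "0 \<le> x e" if "e \<in> parcs G" for e
    using assms(2) that unfolding lp_feasible_def by blast
  have fin: "finite (pverts G)" and finE: "finite (parcs G)"
    by (fact pair_finite_verts pair_finite_arcs)+
  show ?case
  proof (cases "\<pi> r \<le> \<pi> j")
    case True
    have "0 \<le> (\<Sum>e\<in>parcs G. x e * max 0 (\<pi> (fst e) - \<pi> (snd e)))"
      by (intro sum_nonneg mult_nonneg_nonneg x) auto
    then show ?thesis
      using True by linarith
  next
    case False
    \<comment> \<open>Values up to \<open>\<pi> j\<close> are lifted to the next value
      \<open>b\<close>, and the cut \<open>S\<close> pays for the difference.\<close>
    define L where "L = {l \<in> \<pi> ` pverts G. \<pi> j < l}"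
    define b where "b = Min L"
    define S where "S = {v \<in> pverts G. \<pi> v \<le> \<pi> j}"
    define \<pi>' where "\<pi>' v = max b (\<pi> v)" for v
    have L: "finite L" "\<pi> r \<in> L"
      using fin root_in_verts False unfolding L_def by auto
    then have "L \<noteq> {}"
      by blast
    with L have b: "b \<in> L" "b \<le> \<pi> r"
      unfolding b_def using Min_in[of L] Min_le[of L] by blast+
    then have jb: "\<pi> j < b"
      unfolding L_def by blast
    have b_le: "b \<le> \<pi> v" if "v \<in> pverts G - S" for v
      using that L unfolding b_def S_def L_def by auto
    have jV: "j \<in> pverts G"
      using assms(3) terminals_in_verts by blast
    have "card (\<pi>' ` pverts G) < card (\<pi> ` pverts G)"
    proof -
      have "\<pi>' ` pverts G = max b ` (\<pi> ` pverts G)"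
        unfolding \<pi>'_def by (auto simp: image_image)
      also have "\<dots> \<subseteq> \<pi> ` pverts G - {\<pi> j}"
        using b(1) jb unfolding L_def by (auto simp: max_def)
      finally have "card (\<pi>' ` pverts G) \<le> card (\<pi> ` pverts G - {\<pi> j})"
        using fin by (intro card_mono) auto
      also have "\<dots> < card (\<pi> ` pverts G)"
        using fin jV by (intro psubset_card_mono) auto
      finally show ?thesis .
    qed
    from less[OF this] have "\<pi>' r - \<pi>' j \<le> (\<Sum>e\<in>parcs G. x e * max 0 (\<pi>' (fst e) - \<pi>' (snd e)))" .
    then have IH: "\<pi> r - b \<le> (\<Sum>e\<in>parcs G. x e * max 0 (\<pi>' (fst e) - \<pi>' (snd e)))"
      using b jb unfolding \<pi>'_def by simp
    have cut: "1 \<le> (\<Sum>e\<in>delta_in G S. x e)"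
    proof -
      have "S \<subseteq> pverts G - {r}" "S \<inter> X \<noteq> {}"
        using False jV assms(3) unfolding S_def by auto
      then show ?thesis
        using assms(2) unfolding lp_feasible_def by blast
    qed
    have delta: "delta_in G S \<subseteq> parcs G"
      unfolding delta_in_def by auto
    have "\<pi> r - \<pi> j = (\<pi> r - b) + (b - \<pi> j) * 1"
      by simp
    also have "\<dots> \<le> (\<pi> r - b) + (b - \<pi> j) * (\<Sum>e\<in>delta_in G S. x e)"
      using cut jb by (intro add_left_mono mult_left_mono) auto
    also have "(\<Sum>e\<in>delta_in G S. x e) = (\<Sum>e\<in>parcs G. x e * (if e \<in> delta_in G S then 1 else 0))"
      using delta finE by (intro sum.mono_neutral_cong_left) auto
    also have "(\<pi> r - b) + (b - \<pi> j) * \<dots> \<le> (\<Sum>e\<in>parcs G. x e * max 0 (\<pi>' (fst e) - \<pi>' (snd e)))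
      + (b - \<pi> j) * (\<Sum>e\<in>parcs G. x e * (if e \<in> delta_in G S then 1 else 0))"
      using IH by simp
    also have "\<dots> = (\<Sum>e\<in>parcs G. x e * (max 0 (\<pi>' (fst e) - \<pi>' (snd e)) + (if e \<in> delta_in G S then b - \<pi> j else 0)))"
      unfolding sum_distrib_left sum.distrib[symmetric] by (intro sum.cong) (auto simp: algebra_simps)
    also have "\<dots> \<le> (\<Sum>e\<in>parcs G. x e * max 0 (\<pi> (fst e) - \<pi> (snd e)))"
    proof (intro sum_mono mult_left_mono x)
      fix e assume e: "e \<in> parcs G"
      \<comment> \<open>An arc entering \<open>S\<close> falls from at least \<open>b\<close> to at
        most \<open>\<pi> j\<close>, so lifting takes at least \<open>b - \<pi> j\<close> off its
        drop; on no other arc does lifting increase the drop.\<close>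
      show "max 0 (\<pi>' (fst e) - \<pi>' (snd e)) + (if e \<in> delta_in G S then b - \<pi> j else 0)
          \<le> max 0 (\<pi> (fst e) - \<pi> (snd e))"
      proof (cases "e \<in> delta_in G S")
        case True
        then have "b \<le> \<pi> (fst e)" "\<pi> (snd e) \<le> \<pi> j"
          using b_le[of "fst e"] arc_fst_in_verts[OF e] unfolding delta_in_def S_def by auto
        then show ?thesis
          using True jb unfolding \<pi>'_def by auto
      qed (auto simp: \<pi>'_def)
    qed
    finally show ?thesis .
  qed
qed

text \<open>
  \<open>D j v\<close> is the length of a shortest path from \<open>v\<close> to \<open>j\<close>, \<open>g\<close> maps each terminal to the head of its
  group and \<open>H\<close> is the set of heads other than the root. With \<open>\<tau> = \<rho> / 2\<close>, the potentials
  \<open>min \<tau> (D j v)\<close> for \<open>j \<in> H\<close> add up to a feasible dual solution of value \<open>card H * \<tau>\<close>: only the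
  arcs from a terminal to a Steiner node are loaded by several potentials, and for those the density
  bound leaves room for the full load \<open>\<tau>\<close> of the tail's own group on top of the others.
\<close>
lemma density_le_lp:
  fixes \<rho> :: real
  assumes inst: "dst_instance G c r X" and qb: "quasi_bipartite G r X" and feas: "lp_feasible G r X x"
    and H: "H \<subseteq> X - {r}"
    and g: "\<And>j. j \<in> insert r H \<Longrightarrow> g j = j"
    and D_self: "\<And>j. j \<in> H \<Longrightarrow> D j j = Some 0"
    and D_nonneg: "\<And>j v d. D j v = Some d \<Longrightarrow> 0 \<le> d"
    and D_arc: "\<And>j u v d. j \<in> H \<Longrightarrow> (u, v) \<in> parcs G \<Longrightarrow> D j v = Some d \<Longrightarrow> \<exists>d'. D j u = Some d' \<and> d' \<le> c (u, v) + d"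
    and D_first: "\<And>j u d. j \<in> H \<Longrightarrow> D j u = Some d \<Longrightarrow> u \<noteq> j \<Longrightarrow> \<exists>v d'. (u, v) \<in> parcs G \<and> D j v = Some d' \<and> c (u, v) + d' \<le> d"
    and density: "\<And>u s \<theta> J. (u, s) \<in> parcs G \<Longrightarrow> u \<in> insert r X \<Longrightarrow>
      J = {j \<in> H. j \<noteq> g u \<and> (\<exists>d\<le>\<theta>. D j s = Some d)} \<Longrightarrow> J \<noteq> {} \<Longrightarrow>
      \<rho> * card J \<le> c (u, s) + (\<Sum>j\<in>J. the (D j s))"
  shows "card H * \<rho> \<le> 2 * (\<Sum>e\<in>parcs G. c e * x e)"
proof (cases "\<rho> \<le> 0")
  case True
  interpret dst_instance G c r X by fact
  have "0 \<le> (\<Sum>e\<in>parcs G. c e * x e)"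
    using feas by (intro sum_nonneg mult_nonneg_nonneg cost_nonneg) (auto simp: lp_feasible_def)
  moreover have "card H * \<rho> \<le> 0"
    using True by (simp add: mult_nonneg_nonpos)
  ultimately show ?thesis
    by linarith
next
  case False
  interpret dst_instance G c r X by fact
  define \<tau> where "\<tau> = \<rho> / 2"
  have \<tau>: "0 < \<tau>"
    using False unfolding \<tau>_def by simp
  \<comment> \<open>A vertex without a path to \<open>j\<close> counts as lying outside the moat of
    \<open>j\<close>.\<close>
  define \<pi> where "\<pi> j v = (case D j v of None \<Rightarrow> \<tau> | Some d \<Rightarrow> min \<tau> d)" for j v
  have finH: "finite H"
    using H terminals_in_verts pair_finite_verts by (meson finite_Diff finite_subset)
  have \<pi>_le: "\<pi> j v \<le> \<tau>" and \<pi>_nonneg: "0 \<le> \<pi> j v" for j v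
    using \<tau> D_nonneg[of j v] unfolding \<pi>_def by (auto split: option.splits)
  have \<pi>_arc: "\<pi> j u \<le> c (u, v) + \<pi> j v" if "j \<in> H" "(u, v) \<in> parcs G" for j u v
    using D_arc[OF that] cost_nonneg[OF that(2)] unfolding \<pi>_def by (fastforce split: option.splits)
  \<comment> \<open>No moat contains a terminal of a foreign group, nor the root. Otherwise take the
    first arc of a path of length \<open>d < \<tau>\<close> from \<open>u\<close> to
    \<open>j\<close>: with all foreign heads no farther from its end than \<open>j\<close> it would
    have ratio at most \<open>d\<close>, which is below \<open>\<rho>\<close>.\<close>
  have other: "\<pi> j u = \<tau>" if "u \<in> insert r X" "j \<in> H" "j \<noteq> g u" for j u
  proof (rule ccontr)
    assume "\<pi> j u \<noteq> \<tau>"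
    then obtain d where d: "D j u = Some d" "d < \<tau>"
      unfolding \<pi>_def by (auto split: option.splits if_splits simp: min_def not_le)
    have "u \<noteq> j"
      using that g by auto
    from D_first[OF that(2) d(1) this] obtain s d' where
      s: "(u, s) \<in> parcs G" "D j s = Some d'" "c (u, s) + d' \<le> d"
      by blast
    define J where "J = {i \<in> H. i \<noteq> g u \<and> (\<exists>d\<le>d'. D i s = Some d)}"
    have J: "J \<noteq> {}" "finite J"
      using that s(2) finH unfolding J_def by auto
    have "\<rho> * card J \<le> c (u, s) + (\<Sum>i\<in>J. the (D i s))"
      by (rule density[OF s(1) that(1) J_def J(1)])
    also have "(\<Sum>i\<in>J. the (D i s)) \<le> card J * d'"
      by (rule sum_bounded_above) (auto simp: J_def)
    also have "c (u, s) \<le> card J * c (u, s)"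
      using J cost_nonneg[OF s(1)] by (simp add: Suc_leI card_gt_0_iff mult_le_cancel_right1)
    finally have "\<rho> * card J \<le> card J * d"
      using mult_left_mono[OF s(3), of "card J"] by (simp add: algebra_simps)
    then have "\<rho> \<le> d"
      using J by (simp add: mult.commute card_gt_0_iff)
    then show False
      using d(2) \<tau> unfolding \<tau>_def by linarith
  qed
  have load: "(\<Sum>j\<in>H. max 0 (\<pi> j u - \<pi> j v)) \<le> c (u, v)" if uv: "(u, v) \<in> parcs G" for u v
  proof (cases "v \<in> insert r X")
    case True
    \<comment> \<open>At a terminal or the root only the potential of its own head can be below
      \<open>\<tau>\<close>, so at most one term survives.\<close>
    have "(\<Sum>j\<in>H. max 0 (\<pi> j u - \<pi> j v)) = (\<Sum>j\<in>H. if j = g v then max 0 (\<pi> j u - \<pi> j v) else 0)"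
      using other[OF True] \<pi>_le by (intro sum.cong) auto
    also have "\<dots> \<le> c (u, v)"
      using finH \<pi>_arc[OF _ uv] cost_nonneg[OF uv] by (auto simp: algebra_simps)
    finally show ?thesis .
  next
    case False
    then have u: "u \<in> insert r X"
      using qb uv in_arcsD1[OF uv] in_arcsD2[OF uv] unfolding quasi_bipartite_def by fastforce
    define J where "J = {j \<in> H. j \<noteq> g u \<and> (\<exists>d<\<tau>. D j v = Some d)}"
    have finJ: "finite J"
      using finH unfolding J_def by auto
    have own: "max 0 (\<pi> (g u) u - \<pi> (g u) v) \<le> \<tau>"
      using \<pi>_le[of "g u" u] \<pi>_nonneg[of "g u" v] \<tau> by auto
    have "(\<Sum>j\<in>H. max 0 (\<pi> j u - \<pi> j v)) =
        (\<Sum>j\<in>H. (if j = g u then max 0 (\<pi> j u - \<pi> j v) else 0) + (if j \<in> J then \<tau> - the (D j v) else 0))"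
      using other[OF u] unfolding J_def \<pi>_def[of _ v] by (intro sum.cong) (auto split: option.splits simp: min_def)
    also have "\<dots> = (if g u \<in> H then max 0 (\<pi> (g u) u - \<pi> (g u) v) else 0) + (\<Sum>j\<in>J. \<tau> - the (D j v))"
    proof -
      have "(\<Sum>j\<in>H. if j \<in> J then \<tau> - the (D j v) else 0) = (\<Sum>j\<in>J. \<tau> - the (D j v))"
        using finH unfolding J_def by (intro sum.mono_neutral_cong_right) auto
      then show ?thesis
        using finH by (simp add: sum.distrib)
    qed
    also have "\<dots> \<le> c (u, v)"
    proof (cases "J = {}")
      case True
      then show ?thesis
        using \<pi>_arc[OF _ uv, of "g u"] cost_nonneg[OF uv] by auto
    next
      case False
      \<comment> \<open>The density hypothesis speaks of closed thresholds; the largest distance in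
        \<open>J\<close> turns the strict bound by \<open>\<tau>\<close> into one.\<close>
      define \<theta> where "\<theta> = Max ((\<lambda>j. the (D j v)) ` J)"
      have "J = {j \<in> H. j \<noteq> g u \<and> (\<exists>d\<le>\<theta>. D j v = Some d)}"
      proof (intro equalityI subsetI)
        fix j assume "j \<in> J"
        moreover from this have "the (D j v) \<le> \<theta>"
          using finJ unfolding \<theta>_def by simp
        ultimately show "j \<in> {j \<in> H. j \<noteq> g u \<and> (\<exists>d\<le>\<theta>. D j v = Some d)}"
          unfolding J_def by auto
      next
        have "\<theta> \<in> (\<lambda>j. the (D j v)) ` J"
          using finJ False unfolding \<theta>_def by (intro Max_in) auto
        then have "\<theta> < \<tau>"
          unfolding J_def by auto
        then show "j \<in> J" if "j \<in> {j \<in> H. j \<noteq> g u \<and> (\<exists>d\<le>\<theta>. D j v = Some d)}" for j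
          using that unfolding J_def by auto
      qed
      \<comment> \<open>This is where \<open>\<tau>\<close> has to be half of \<open>\<rho>\<close>:
        the load of \<open>J\<close> is at most \<open>c (u, v) - \<tau> * card J\<close>, and since
        \<open>J\<close> is nonempty, this leaves \<open>\<tau>\<close> for the moat of the tail's
        own head.\<close>
      from density[OF uv u this False] have "2 * \<tau> * card J \<le> c (u, v) + (\<Sum>j\<in>J. the (D j v))"
        unfolding \<tau>_def by simp
      moreover have "\<tau> \<le> \<tau> * card J"
        using False finJ \<tau> by (simp add: Suc_leI card_gt_0_iff)
      moreover have "(\<Sum>j\<in>J. \<tau> - the (D j v)) = \<tau> * card J - (\<Sum>j\<in>J. the (D j v))"
        by (simp add: sum_subtractf)
      moreover have "2 * \<tau> * card J = \<tau> * card J + \<tau> * card J"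
        by simp
      ultimately show ?thesis
        using own \<tau> by (cases "g u \<in> H"; simp only: if_True if_False; linarith)
    qed
    finally show ?thesis .
  qed
  have "card H * \<tau> = (\<Sum>j\<in>H. \<pi> j r - \<pi> j j)"
    using H g other[of r] D_self \<tau> by (simp add: \<pi>_def sum.cong subset_iff)
  also have "\<dots> \<le> (\<Sum>j\<in>H. \<Sum>e\<in>parcs G. x e * max 0 (\<pi> j (fst e) - \<pi> j (snd e)))"
    using H by (intro sum_mono lp_potential[OF inst feas]) auto
  also have "\<dots> = (\<Sum>e\<in>parcs G. x e * (\<Sum>j\<in>H. max 0 (\<pi> j (fst e) - \<pi> j (snd e))))"
    by (subst sum.swap) (simp add: sum_distrib_left)
  also have "\<dots> \<le> (\<Sum>e\<in>parcs G. x e * c e)"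
    using feas load by (intro sum_mono mult_left_mono) (auto simp: lp_feasible_def)
  finally show ?thesis
    unfolding \<tau>_def by (simp add: mult.commute)
qed

section \<open>Shortest paths and greedy merging\<close>

type_synonym 'v path = "('v \<times> 'v) list"

type_synonym ('v, 'c) weighted_arcs = "(('v \<times> 'v) \<times> 'c) list"

type_synonym ('v, 'c) path_labels = "('v \<times> 'c \<times> 'v path) list"

text \<open>Candidates of a Bellman-Ford step for paths from \<open>v\<close> to \<open>h\<close>.
  Labels store the path itself, so a merge can list its arcs without following pointers.\<close>

definition label_cands :: "('v, 'c :: plus) weighted_arcs \<Rightarrow> 'c \<Rightarrow> 'v \<Rightarrow> ('v, 'c) path_labels \<Rightarrow> 'v \<Rightarrow> ('c \<times> 'v path) list" where
  "label_cands E z h T v = (if v = h then [(z, [])] else []) @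
     concat (map (\<lambda>e. if fst (fst e) = v
       then concat (map (\<lambda>l. if fst l = snd (fst e) then [(snd e + fst (snd l), fst e # snd (snd l))] else []) T)
       else []) E)"

lemma label_cands_iff:
  "(z, p) \<in> set (label_cands E z\<^sub>0 h T v) \<longleftrightarrow> v = h \<and> z = z\<^sub>0 \<and> p = [] \<or>
    (\<exists>u y z' p'. ((v, u), y) \<in> set E \<and> (u, z', p') \<in> set T \<and> z = y + z' \<and> p = (v, u) # p')"
  unfolding label_cands_def by (auto split: if_splits) force+

definition label_round :: "'v list \<Rightarrow> ('v, 'c :: linordered_idom) weighted_arcs \<Rightarrow> 'v \<Rightarrow> ('v, 'c) path_labels \<Rightarrow> ('v, 'c) path_labels" where
  "label_round V E h T = concat (map (\<lambda>v. map (\<lambda>a. (v, a)) (pick (\<lambda>a b. fst a < fst b) (label_cands E 0 h T v))) V)"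

text \<open>The fold runs over \<open>V\<close> only to count rounds: some shortest path has fewer
  arcs than there are vertices.\<close>

definition labels :: "'v list \<Rightarrow> ('v, 'c :: linordered_idom) weighted_arcs \<Rightarrow> 'v \<Rightarrow> ('v, 'c) path_labels" where
  "labels V E h = fold (\<lambda>_ T. label_round V E h T) V []"

definition label_table :: "'v list \<Rightarrow> ('v, 'c :: linordered_idom) weighted_arcs \<Rightarrow> 'v list \<Rightarrow> ('v \<times> ('v, 'c) path_labels) list" where
  "label_table V E X = map (\<lambda>h. (h, labels V E h)) X"

text \<open>An entry \<open>(t, i)\<close> of \<open>P\<close> puts \<open>t\<close> into the group
  headed by \<open>i\<close>, so heads are the fixed points. The root is excluded because it must
  stay a head to the end.\<close>

definition targets :: "'v \<Rightarrow> ('v \<times> ('v, 'c) path_labels) list \<Rightarrow> ('v \<times> 'v) list \<Rightarrow> 'v \<Rightarrow> 'v \<Rightarrow> ('v, 'c) path_labels" where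
  "targets r A P s i = concat (map (\<lambda>a.
     if fst a \<noteq> i \<and> fst a \<noteq> r \<and> (\<exists>q\<in>set P. fst q = fst a \<and> snd q = fst a)
     then map (\<lambda>l. (fst a, snd l)) (filter (\<lambda>l. fst l = s) (snd a)) else []) A)"

text \<open>A merge is \<open>((cost, number of heads), (new head, merged heads), arcs)\<close>.\<close>
type_synonym ('v, 'c) merge = "('c \<times> 'c) \<times> ('v \<times> 'v list) \<times> 'v path"

text \<open>The number of heads is a sum of ones in the cost ring, so that ratios can be compared
  there by cross-multiplication.\<close>

definition merge_of :: "('v \<times> 'v) \<times> 'c \<Rightarrow> 'v \<Rightarrow> ('v, 'c :: linordered_idom) path_labels \<Rightarrow> ('v, 'c) merge" where
  "merge_of e i J = ((snd e + sum_list (map (\<lambda>a. fst (snd a)) J), sum_list (map (\<lambda>a. 1) J)),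
     (i, map fst J), fst e # concat (map (\<lambda>a. snd (snd a)) J))"

text \<open>Only distances that occur are tried as thresholds, which leaves at most one candidate
  per target instead of one per subset.\<close>

definition threshold_merges :: "('v \<times> 'v) \<times> 'c \<Rightarrow> 'v \<Rightarrow> ('v, 'c :: linordered_idom) path_labels \<Rightarrow> ('v, 'c) merge list" where
  "threshold_merges e i R = map (\<lambda>b. merge_of e i (filter (\<lambda>a. fst (snd a) \<le> fst (snd b)) R)) R"

definition merges :: "'v \<Rightarrow> ('v, 'c :: linordered_idom) weighted_arcs \<Rightarrow> ('v \<times> ('v, 'c) path_labels) list \<Rightarrow> ('v \<times> 'v) list \<Rightarrow> ('v, 'c) merge list" where
  "merges r E A P = concat (map (\<lambda>e. concat (map (\<lambda>q. if fst q = fst (fst e)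
     then threshold_merges e (snd q) (targets r A P (snd (fst e)) (snd q)) else []) P)) E)"

definition cheaper :: "('v, 'c :: linordered_idom) merge \<Rightarrow> ('v, 'c) merge \<Rightarrow> bool" where
  "cheaper a b \<longleftrightarrow> fst (fst a) * snd (fst b) < fst (fst b) * snd (fst a)"

definition apply_merge :: "('v, 'c) merge \<Rightarrow> ('v \<times> 'v) list \<times> 'v path \<Rightarrow> ('v \<times> 'v) list \<times> 'v path" where
  "apply_merge m st = (map (\<lambda>q. (fst q, if snd q \<in> set (snd (fst (snd m))) then fst (fst (snd m)) else snd q)) (fst st),
     snd (snd m) @ snd st)"

definition greedy_step where
  "greedy_step r E A st = (if pick cheaper (merges r E A (fst st)) = [] then st
     else apply_merge (hd (pick cheaper (merges r E A (fst st)))) st)"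

definition init_groups :: "'v \<Rightarrow> 'v list \<Rightarrow> ('v \<times> 'v) list" where
  "init_groups r X = (r, r) # map (\<lambda>t. (t, t)) (filter (\<lambda>t. t \<noteq> r) X)"

text \<open>\<open>X\<close> counts the rounds, which suffices as each merge removes a head.\<close>

definition greedy_tree :: "'v list \<Rightarrow> ('v, 'c :: linordered_idom) weighted_arcs \<Rightarrow> 'v \<Rightarrow> 'v list \<Rightarrow> 'v path" where
  "greedy_tree V E r X = snd (fold (\<lambda>_ st. greedy_step r E (label_table V E X) st) X (init_groups r X, []))"

section \<open>Walks and reachability by arc lists\<close>

lemma pcas_append: "pcas u p v \<Longrightarrow> pcas v q w \<Longrightarrow> pcas u (p @ q) w"
  by (induction u p v rule: pcas.induct) auto

definition reach :: "('v \<times> 'v) set \<Rightarrow> 'v \<Rightarrow> 'v \<Rightarrow> bool" where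
  "reach F u v \<longleftrightarrow> (\<exists>p. set p \<subseteq> F \<and> pcas u p v)"

lemma reach_refl: "reach F u u"
  unfolding reach_def by (intro exI[of _ "[]"]) auto

lemma reach_trans: "reach F u v \<Longrightarrow> reach F v w \<Longrightarrow> reach F u w"
  unfolding reach_def by (metis pcas_append set_append Un_least)

lemma reach_mono: "reach F u v \<Longrightarrow> F \<subseteq> F' \<Longrightarrow> reach F' u v"
  unfolding reach_def by blast

lemma reach_arc: "(u, v) \<in> F \<Longrightarrow> reach F u v"
  unfolding reach_def by (intro exI[of _ "[(u, v)]"]) auto

text \<open>With nonnegative costs, cutting out a closed subwalk does not make a walk dearer, and a
  walk without repeated vertices has fewer arcs than there are vertices.\<close>

lemma (in pair_fin_digraph) short_walk:
  assumes c: "\<And>e. e \<in> parcs G \<Longrightarrow> 0 \<le> (c e :: real)"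
    and "u \<in> pverts G" "pcas u p v" "set p \<subseteq> parcs G"
  shows "\<exists>q. pcas u q v \<and> set q \<subseteq> parcs G \<and> length q < card (pverts G) \<and> sum_list (map c q) \<le> sum_list (map c p)"
  using assms(3,4)
proof (induction "length p" arbitrary: p rule: less_induct)
  case less
  have walk: "awalk u p v"
    using less.prems assms(2) unfolding awalk_def by auto
  show ?case
  proof (cases "distinct (awalk_verts u p)")
    case True
    then have "apath u p v"
      using walk unfolding apath_def by simp
    then show ?thesis
      using length_apath_less less.prems by fastforce
  next
    case False
    from awalk_not_distinct_decomp[OF walk this] obtain q s t w where
      p: "p = q @ s @ t" "0 < length s" "awalk u q w" "awalk w s w" "awalk w t v"
      by blast
    have "pcas u (q @ t) v"
      using p(3,5) unfolding awalk_def cas_with_proj_eq by (blast intro: pcas_append)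
    moreover have "set (q @ t) \<subseteq> parcs G"
      using less.prems p(1) by auto
    moreover have "length (q @ t) < length p"
      using p by simp
    ultimately obtain q' where q': "pcas u q' v" "set q' \<subseteq> parcs G" "length q' < card (pverts G)"
      "sum_list (map c q') \<le> sum_list (map c (q @ t))"
      using less.hyps[of "q @ t"] by blast
    moreover have "0 \<le> sum_list (map c s)"
      using less.prems c p(1) by (intro sum_list_nonneg) auto
    ultimately show ?thesis
      using p(1) by (intro exI[of _ q']) auto
  qed
qed

lemma distinct_fst_concat:
  assumes "distinct xs" "\<And>x. x \<in> set xs \<Longrightarrow> length (f x) \<le> 1"
  shows "distinct (map fst (concat (map (\<lambda>x. map (\<lambda>a. (x, a)) (f x)) xs)))"
  using assms
proof (induction xs)
  case (Cons x xs)
  have "length (f x) \<le> 1"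
    using Cons.prems by simp
  then consider "f x = []" | a where "f x = [a]"
    by (cases "f x") auto
  then show ?case
    by cases (use Cons in auto)
qed simp

lemma length_filter_fst_le:
  assumes "distinct (map fst xs)"
  shows "length (filter (\<lambda>l. fst l = s) xs) \<le> 1"
proof -
  have "distinct (map fst (filter (\<lambda>l. fst l = s) xs))"
    using assms by (simp add: distinct_map_filter)
  moreover have "set (map fst (filter (\<lambda>l. fst l = s) xs)) \<subseteq> {s}"
    by auto
  ultimately have "length (map fst (filter (\<lambda>l. fst l = s) xs)) \<le> card {s}"
    by (metis card_mono distinct_card finite.emptyI finite.insertI)
  then show ?thesis
    by simp
qed

text \<open>
  The costs that the algorithm computes with live in an arbitrary ordered ring and are related to the
  real costs by an order embedding \<open>\<phi>\<close>: real costs themselves for the integrality gap, and integers after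
  multiplication by a common denominator for the program.
\<close>
locale greedy_input =
  fixes G :: "'v pair_pre_digraph" and c :: "'v \<times> 'v \<Rightarrow> real" and r :: 'v and X V :: "'v list"
    and E :: "('v, 'c :: linordered_idom) weighted_arcs" and \<phi> :: "'c \<Rightarrow> real"
  assumes inst: "dst_instance G c r (set X)"
    and qb: "quasi_bipartite G r (set X)"
    and verts: "pverts G = set V" "distinct V"
    and arcs: "parcs G = fst ` set E"
    and dX: "distinct X"
    and cost: "\<And>e z. (e, z) \<in> set E \<Longrightarrow> \<phi> z = c e"
    and \<phi>_add: "\<And>a b. \<phi> (a + b) = \<phi> a + \<phi> b"
    and \<phi>_mult: "\<And>a n. \<phi> (a * of_nat n) = \<phi> a * of_nat n"
    and \<phi>_less: "\<And>a b. \<phi> a < \<phi> b \<longleftrightarrow> a < b"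
begin

sublocale dst_instance G c r "set X"
  by (rule inst)

lemma \<phi>_0 [simp]: "\<phi> 0 = 0"
  using \<phi>_add[of 0 0] by simp

lemma \<phi>_le: "\<phi> a \<le> \<phi> b \<longleftrightarrow> a \<le> b"
  by (simp add: \<phi>_less flip: not_less)

lemma \<phi>_sum_list: "\<phi> (sum_list xs) = sum_list (map \<phi> xs)"
  by (induction xs) (auto simp: \<phi>_add)

section \<open>Correctness of the distance table\<close>

definition walk :: "'v \<Rightarrow> 'v path \<Rightarrow> 'v \<Rightarrow> bool" where
  "walk u p v \<longleftrightarrow> pcas u p v \<and> set p \<subseteq> parcs G"

definition len :: "'v path \<Rightarrow> real" where
  "len p = sum_list (map c p)"

lemma len_simps [simp]: "len [] = 0" "len (e # p) = c e + len p" "len (p @ q) = len p + len q"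
  by (auto simp: len_def)

lemma len_nonneg: "set p \<subseteq> parcs G \<Longrightarrow> 0 \<le> len p"
  unfolding len_def by (intro sum_list_nonneg) (auto intro: cost_nonneg)

text \<open>After \<open>n\<close> rounds the labels are optimal against walks of fewer than \<open>n\<close> arcs.\<close>
definition labelled :: "'v \<Rightarrow> nat \<Rightarrow> ('v, 'c) path_labels \<Rightarrow> bool" where
  "labelled h n T \<longleftrightarrow> distinct (map fst T)
    \<and> (\<forall>v z p. (v, z, p) \<in> set T \<longrightarrow> v \<in> set V \<and> walk v p h \<and> \<phi> z = len p)
    \<and> (\<forall>v q. v \<in> set V \<longrightarrow> walk v q h \<longrightarrow> length q < n \<longrightarrow> (\<exists>z p. (v, z, p) \<in> set T \<and> \<phi> z \<le> len q))"

text \<open>A nonempty walk is an arc followed by a walk with one arc fewer, whose start already has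
  a label that is no dearer. The candidate built from it bounds the minimum that \<open>pick\<close>
  selects.\<close>

lemma labelled_round:
  assumes "labelled h n T"
  shows "labelled h (Suc n) (label_round V E h T)"
proof -
  let ?C = "\<lambda>v. label_cands E 0 h T v"
  let ?pick = "\<lambda>v. pick (\<lambda>a b. fst a < fst b) (?C v)"
  have sound: "walk v p h \<and> \<phi> z = len p" if "(z, p) \<in> set (?C v)" for v z p
  proof (cases "v = h \<and> z = 0 \<and> p = []")
    case True
    then show ?thesis
      unfolding walk_def by simp
  next
    case False
    then obtain u z0 z' p' where *: "((v, u), z0) \<in> set E" "(u, z', p') \<in> set T" "z = z0 + z'" "p = (v, u) # p'"
      using \<open>(z, p) \<in> set (?C v)\<close> unfolding label_cands_iff by blast
    then have "walk u p' h" "\<phi> z' = len p'"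
      using assms unfolding labelled_def by blast+
    moreover have "(v, u) \<in> parcs G"
      using *(1) unfolding arcs by force
    ultimately show ?thesis
      using * cost[OF *(1)] unfolding walk_def by (simp add: \<phi>_add)
  qed
  have mem: "(v, a) \<in> set (label_round V E h T) \<longleftrightarrow> v \<in> set V \<and> a \<in> set (?pick v)" for v a
    unfolding label_round_def by auto
  have pick_sub: "set (?pick v) \<subseteq> set (?C v)" for v
    using pick_cases[of "?C v" "\<lambda>a b. fst a < fst b"] by fastforce
  have "length (?pick v) \<le> 1" for v
    using pick_cases[of "?C v" "\<lambda>a b. fst a < fst b"] by fastforce
  then have "distinct (map fst (label_round V E h T))"
    unfolding label_round_def by (intro distinct_fst_concat verts)
  moreover have "\<exists>z p. (v, z, p) \<in> set (label_round V E h T) \<and> \<phi> z \<le> len q"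
    if v: "v \<in> set V" and q: "walk v q h" "length q < Suc n" for v q
  proof -
    have "\<exists>a\<in>set (?C v). \<phi> (fst a) \<le> len q"
    proof (cases q)
      case Nil
      then show ?thesis
        using q unfolding walk_def by (intro bexI[of _ "(0, [])"]) (auto simp: label_cands_iff)
    next
      case (Cons e q')
      then have e: "e \<in> parcs G" "fst e = v" "walk (snd e) q' h"
        using q unfolding walk_def by auto
      then obtain z where z: "(e, z) \<in> set E"
        unfolding arcs by auto
      have "snd e \<in> set V"
        using arc_snd_in_verts[OF e(1)] verts by simp
      then obtain z' p where z': "(snd e, z', p) \<in> set T" "\<phi> z' \<le> len q'"
      proof -
        have "length q' < n"
          using q(2) Cons by simp
        with \<open>snd e \<in> set V\<close> e(3) assms show ?thesis
          unfolding labelled_def using that by blast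
      qed
      have "(z + z', e # p) \<in> set (?C v)"
        using z z'(1) e(2) unfolding label_cands_iff by (cases e) auto
      then show ?thesis
        using cost[OF z] z'(2) Cons by (intro bexI[of _ "(z + z', e # p)"]) (auto simp: \<phi>_add)
    qed
    then obtain a where a: "a \<in> set (?C v)" "\<phi> (fst a) \<le> len q"
      by blast
    then obtain b where b: "?pick v = [b]"
      using pick_cases[of "?C v" "\<lambda>a b. fst a < fst b"] by auto
    have "\<not> fst a < fst b"
      using pick_minimal[of UNIV "\<lambda>a b. fst a < fst b" "?C v" b a] a b by auto
    then have "\<phi> (fst b) \<le> len q"
      using a(2) \<phi>_less[of "fst a" "fst b"] by linarith
    moreover have "(v, fst b, snd b) \<in> set (label_round V E h T)"
      using mem[of v b] v b by simp
    ultimately show ?thesis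
      by blast
  qed
  moreover have "v \<in> set V \<and> walk v p h \<and> \<phi> z = len p" if "(v, z, p) \<in> set (label_round V E h T)" for v z p
    using that sound pick_sub mem by blast
  ultimately show ?thesis
    unfolding labelled_def by blast
qed

lemma labelled_labels: "labelled h (length V) (labels V E h)"
proof -
  have "labelled h (length xs) (fold (\<lambda>_ T. label_round V E h T) xs [])" for xs :: "'v list"
  proof (induction xs rule: rev_induct)
    case Nil
    then show ?case
      unfolding labelled_def by simp
  qed (simp add: labelled_round)
  then show ?thesis
    unfolding labels_def .
qed

text \<open>Distances are read off the table, so that the dual argument and the algorithm refer to
  the same numbers.\<close>

definition D :: "'v \<Rightarrow> 'v \<Rightarrow> real option" where
  "D j v = map_option (\<lambda>a. \<phi> (fst a)) (map_of (labels V E j) v)"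

lemma label_D: "(v, z, p) \<in> set (labels V E j) \<Longrightarrow> D j v = Some (\<phi> z)"
  using labelled_labels[of j] unfolding D_def labelled_def by simp

lemma D_label: "D j v = Some d \<Longrightarrow> \<exists>z p. (v, z, p) \<in> set (labels V E j) \<and> d = \<phi> z"
  unfolding D_def by (auto dest: map_of_SomeD)

lemma label_walk: "(v, z, p) \<in> set (labels V E j) \<Longrightarrow> walk v p j \<and> \<phi> z = len p"
  using labelled_labels[of j] unfolding labelled_def by blast

lemma D_walk: "D j v = Some d \<Longrightarrow> \<exists>p. walk v p j \<and> len p = d"
  using D_label label_walk by metis

text \<open>Cutting out cycles extends the optimality of the labels from walks with fewer arcs than
  vertices to all walks.\<close>

lemma D_le_len:
  assumes "v \<in> pverts G" "walk v p j"
  shows "\<exists>d. D j v = Some d \<and> d \<le> len p"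
proof -
  obtain q where q: "walk v q j" "length q < length V" "len q \<le> len p"
    using short_walk[of c v p j] assms cost_nonneg verts distinct_card[of V] unfolding walk_def len_def by auto
  then obtain z p' where "(v, z, p') \<in> set (labels V E j)" "\<phi> z \<le> len q"
    using labelled_labels[of j] assms(1) verts(1) unfolding labelled_def by blast
  then show ?thesis
    using label_D q(3) by fastforce
qed

lemma D_nonneg: "D j v = Some d \<Longrightarrow> 0 \<le> d"
  using D_walk len_nonneg unfolding walk_def by blast

lemma D_self:
  assumes "j \<in> pverts G"
  shows "D j j = Some 0"
  using D_le_len[OF assms, of "[]" j] D_nonneg[of j j] unfolding walk_def by force

lemma D_arc:
  assumes "(u, v) \<in> parcs G" "D j v = Some d"
  shows "\<exists>d'. D j u = Some d' \<and> d' \<le> c (u, v) + d"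
proof -
  obtain p where "walk v p j" "len p = d"
    using D_walk[OF assms(2)] by blast
  then show ?thesis
    using D_le_len[of u "(u, v) # p" j] assms(1) in_arcsD1 unfolding walk_def by auto
qed

lemma D_first:
  assumes "D j u = Some d" "u \<noteq> j"
  shows "\<exists>v d'. (u, v) \<in> parcs G \<and> D j v = Some d' \<and> c (u, v) + d' \<le> d"
proof -
  obtain p where p: "walk u p j" "len p = d"
    using D_walk[OF assms(1)] by blast
  then obtain e q where "p = e # q"
    using assms(2) unfolding walk_def by (cases p) auto
  then show ?thesis
    using p D_le_len[of "snd e" q j] arc_snd_in_verts[of e] unfolding walk_def by (cases e) auto
qed

end

text \<open>The difference consists of \<open>n\<close> reciprocals, none below
  \<open>1 / l\<close>. Charging \<open>1 / l\<close> for each head removed at once therefore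
  telescopes to a harmonic number.\<close>

lemma card_div_le_harm_diff:
  assumes "n \<le> l"
  shows "real n / real l \<le> harm l - harm (l - n)"
proof -
  have "harm l - harm (l - n) = (\<Sum>k\<in>{l - n<..l}. inverse (real k))"
  proof -
    have "{1..l} = {1..l - n} \<union> {l - n<..l}"
      using assms by auto
    then have "harm l = (\<Sum>k\<in>{1..l - n} \<union> {l - n<..l}. inverse (real k))"
      unfolding harm_def by simp
    also have "\<dots> = harm (l - n) + (\<Sum>k\<in>{l - n<..l}. inverse (real k))"
      unfolding harm_def by (rule sum.union_disjoint) auto
    finally show ?thesis
      by simp
  qed
  moreover have "(\<Sum>k\<in>{l - n<..l}. inverse (real l)) \<le> (\<Sum>k\<in>{l - n<..l}. inverse (real k))"
    by (intro sum_mono le_imp_inverse_le) auto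
  ultimately show ?thesis
    using assms by (simp add: divide_inverse)
qed

section \<open>Groups, merges and the harmonic budget\<close>

context greedy_input
begin

abbreviation "A \<equiv> label_table V E X"

definition heads :: "('v \<times> 'v) list \<Rightarrow> 'v set" where
  "heads P = {t. (t, t) \<in> set P \<and> t \<noteq> r}"

text \<open>Prescribing the list of keys makes them distinct, so \<open>P\<close> is a function; a
  merge rewrites second components only.\<close>

definition groups_ok :: "('v \<times> 'v) list \<Rightarrow> bool" where
  "groups_ok P \<longleftrightarrow> map fst P = r # filter (\<lambda>t. t \<noteq> r) X \<and> (r, r) \<in> set P \<and> (\<forall>t i. (t, i) \<in> set P \<longrightarrow> (i, i) \<in> set P)"

lemma groups_fun: "groups_ok P \<Longrightarrow> (t, i) \<in> set P \<Longrightarrow> (t, j) \<in> set P \<Longrightarrow> i = j"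
  using dX eq_key_imp_eq_value[of P t i j] unfolding groups_ok_def by auto

lemma groups_dom: "groups_ok P \<Longrightarrow> fst ` set P = insert r (set X)"
  unfolding groups_ok_def by (auto simp flip: set_map)

lemma heads_subset: "groups_ok P \<Longrightarrow> heads P \<subseteq> set X - {r}"
  using groups_dom[of P] unfolding heads_def by force

lemma finite_heads: "groups_ok P \<Longrightarrow> finite (heads P)"
  using heads_subset finite_subset by blast

lemma in_targets: "(j, z, p) \<in> set (targets r A P s i) \<longleftrightarrow>
    j \<in> heads P \<and> j \<in> set X \<and> j \<noteq> i \<and> (s, z, p) \<in> set (labels V E j)"
  unfolding targets_def label_table_def heads_def by (force split: if_splits)

lemma distinct_targets: "distinct (map fst (targets r A P s i))"
proof -
  define f where "f j = (if j \<noteq> i \<and> j \<noteq> r \<and> (\<exists>q\<in>set P. fst q = j \<and> snd q = j)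
    then map snd (filter (\<lambda>l. fst l = s) (labels V E j)) else [])" for j
  have "targets r A P s i = concat (map (\<lambda>j. map (\<lambda>a. (j, a)) (f j)) X)"
    unfolding targets_def label_table_def f_def map_map by (intro arg_cong[of _ _ concat] map_cong) auto
  moreover have "length (f j) \<le> 1" for j
    using length_filter_fst_le[of "labels V E j" s] labelled_labels[of j] unfolding f_def labelled_def by simp
  ultimately show ?thesis
    using distinct_fst_concat[OF dX, of f] by simp
qed

definition merge_ok :: "('v \<times> 'v) list \<Rightarrow> ('v, 'c) merge \<Rightarrow> bool" where
  "merge_ok P m \<longleftrightarrow> (\<exists>u s i J. (u, s) \<in> parcs G \<and> (u, i) \<in> set P \<and> J \<subseteq> heads P - {i} \<and> J \<noteq> {} \<and>
      \<phi> (fst (fst m)) = c (u, s) + (\<Sum>j\<in>J. the (D j s)) \<and> snd (fst m) = of_nat (card J) \<and>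
      fst (fst (snd m)) = i \<and> set (snd (fst (snd m))) = J \<and> len (snd (snd m)) = \<phi> (fst (fst m)) \<and>
      set (snd (snd m)) \<subseteq> parcs G \<and> (\<forall>j\<in>J. reach (set (snd (snd m))) u j))"

lemma threshold_set:
  assumes "R = targets r A P s i" "groups_ok P"
  shows "fst ` set (filter (\<lambda>a. fst (snd a) \<le> y) R) = {j \<in> heads P. j \<noteq> i \<and> (\<exists>d\<le>\<phi> y. D j s = Some d)}"
proof (intro equalityI subsetI)
  fix j assume "j \<in> fst ` set (filter (\<lambda>a. fst (snd a) \<le> y) R)"
  then obtain z p where "(j, z, p) \<in> set R" "z \<le> y"
    by auto
  then show "j \<in> {j \<in> heads P. j \<noteq> i \<and> (\<exists>d\<le>\<phi> y. D j s = Some d)}"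
    using assms(1) label_D[of s z p j] by (auto simp: in_targets \<phi>_le)
next
  fix j assume j: "j \<in> {j \<in> heads P. j \<noteq> i \<and> (\<exists>d\<le>\<phi> y. D j s = Some d)}"
  then obtain z p where z: "(s, z, p) \<in> set (labels V E j)" "z \<le> y"
    using D_label[of j s] by (auto simp: \<phi>_le)
  then have "(j, z, p) \<in> set (filter (\<lambda>a. fst (snd a) \<le> y) R)"
    using assms j heads_subset by (auto simp: in_targets)
  then show "j \<in> fst ` set (filter (\<lambda>a. fst (snd a) \<le> y) R)"
    by force
qed

text \<open>The last two claims are stated outside \<open>merge_ok\<close>, which hides its witness
  set, because the density argument needs them for a set given in advance.\<close>

lemma merge_of_ok:
  assumes P: "groups_ok P" and e: "((u, s), z) \<in> set E" and i: "(u, i) \<in> set P"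
    and R: "set J \<subseteq> set (targets r A P s i)" "distinct (map fst J)" "J \<noteq> []"
  shows "merge_ok P (merge_of ((u, s), z) i J)"
    and "\<phi> (fst (fst (merge_of ((u, s), z) i J))) = c (u, s) + (\<Sum>j\<in>fst ` set J. the (D j s))"
    and "snd (fst (merge_of ((u, s), z) i J)) = of_nat (card (fst ` set J))"
proof -
  let ?m = "merge_of ((u, s), z) i J"
  have us: "(u, s) \<in> parcs G"
    using e unfolding arcs by force
  have J: "a \<in> set J \<Longrightarrow> fst a \<in> heads P - {i} \<and> (s, snd a) \<in> set (labels V E (fst a))" for a
    using R(1) in_targets[of "fst a" "fst (snd a)" "snd (snd a)"] by auto
  have J': "a \<in> set J \<Longrightarrow> the (D (fst a) s) = \<phi> (fst (snd a)) \<and> walk s (snd (snd a)) (fst a)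
      \<and> len (snd (snd a)) = \<phi> (fst (snd a))" for a
    using J[of a] label_D[of s "fst (snd a)" "snd (snd a)"] label_walk[of s "fst (snd a)" "snd (snd a)"] by auto
  have "(\<Sum>a\<leftarrow>J. \<phi> (fst (snd a))) = (\<Sum>a\<leftarrow>J. the (D (fst a) s))"
    using J' by (intro arg_cong[of _ _ sum_list] map_cong) auto
  then have sum: "\<phi> (\<Sum>a\<leftarrow>J. fst (snd a)) = (\<Sum>j\<in>fst ` set J. the (D j s))"
    using sum_list_distinct_conv_sum_set[OF R(2), of "\<lambda>j. the (D j s)"] by (simp add: \<phi>_sum_list o_def)
  then show 1: "\<phi> (fst (fst ?m)) = c (u, s) + (\<Sum>j\<in>fst ` set J. the (D j s))"
    using cost[OF e] unfolding merge_of_def by (simp add: \<phi>_add)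
  have "(\<Sum>a\<leftarrow>J. 1) = (of_nat (length J) :: 'c)"
    by (induction J) auto
  then show 2: "snd (fst ?m) = of_nat (card (fst ` set J))"
    using distinct_card[OF R(2)] unfolding merge_of_def by simp
  have "len (concat (map (\<lambda>a. snd (snd a)) K)) = \<phi> (\<Sum>a\<leftarrow>K. fst (snd a))" if "set K \<subseteq> set J" for K
    using that by (induction K) (auto simp: J' \<phi>_add)
  then have 3: "len (snd (snd ?m)) = \<phi> (fst (fst ?m))"
    using cost[OF e] unfolding merge_of_def by (simp add: \<phi>_add)
  have 4: "set (snd (snd ?m)) \<subseteq> parcs G"
    using us J' unfolding merge_of_def walk_def by fastforce
  have 5: "reach (set (snd (snd ?m))) u j" if j: "j \<in> fst ` set J" for j
  proof -
    obtain a where a: "a \<in> set J" "j = fst a"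
      using j by blast
    have "reach (set (snd (snd a))) s j"
      using J'[OF a(1)] a(2) unfolding walk_def reach_def by blast
    then have "reach (set (snd (snd ?m))) s j"
      by (rule reach_mono) (use a(1) in \<open>auto simp: merge_of_def\<close>)
    moreover have "reach (set (snd (snd ?m))) u s"
      by (rule reach_arc) (simp add: merge_of_def)
    ultimately show ?thesis
      by (meson reach_trans)
  qed
  show "merge_ok P ?m"
    unfolding merge_ok_def
    by (intro exI[of _ u] exI[of _ s] exI[of _ i] exI[of _ "fst ` set J"])
      (use us i J R(3) 1 2 3 4 5 in \<open>auto simp: merge_of_def\<close>)
qed

lemma in_merges:
  assumes "m \<in> set (merges r E A P)"
  obtains u s z i b where "((u, s), z) \<in> set E" "(u, i) \<in> set P" "b \<in> set (targets r A P s i)"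
    "m = merge_of ((u, s), z) i (filter (\<lambda>a. fst (snd a) \<le> fst (snd b)) (targets r A P s i))"
proof -
  obtain e q where eq: "e \<in> set E" "q \<in> set P" "fst q = fst (fst e)"
    and m: "m \<in> set (threshold_merges e (snd q) (targets r A P (snd (fst e)) (snd q)))"
    using assms unfolding merges_def by (auto split: if_splits)
  obtain b where "b \<in> set (targets r A P (snd (fst e)) (snd q))"
    "m = merge_of e (snd q) (filter (\<lambda>a. fst (snd a) \<le> fst (snd b)) (targets r A P (snd (fst e)) (snd q)))"
    using m unfolding threshold_merges_def by auto
  with that[of "fst (fst e)" "snd (fst e)" "snd e" "snd q" b] eq show thesis
    by (metis prod.collapse)
qed

lemma merges_in:
  assumes "((u, s), z) \<in> set E" "(u, i) \<in> set P" "b \<in> set (targets r A P s i)"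
  shows "merge_of ((u, s), z) i (filter (\<lambda>a. fst (snd a) \<le> fst (snd b)) (targets r A P s i)) \<in> set (merges r E A P)"
  using assms unfolding merges_def threshold_merges_def by force

lemma merges_ok:
  assumes "groups_ok P" "m \<in> set (merges r E A P)"
  shows "merge_ok P m"
  using assms(2)
proof (rule in_merges)
  fix u s z i b
  assume *: "((u, s), z) \<in> set E" "(u, i) \<in> set P" "b \<in> set (targets r A P s i)"
    "m = merge_of ((u, s), z) i (filter (\<lambda>a. fst (snd a) \<le> fst (snd b)) (targets r A P s i))"
  show ?thesis
    unfolding *(4)
    by (intro merge_of_ok assms *) (use distinct_targets *(3) in \<open>auto simp: distinct_map_filter filter_empty_conv\<close>)
qed

lemma pick_cheapest:
  assumes P: "groups_ok P" and m: "pick cheaper (merges r E A P) = [m]" and m': "m' \<in> set (merges r E A P)"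
    and n: "snd (fst m) = of_nat n" "snd (fst m') = of_nat n'"
  shows "\<phi> (fst (fst m)) * real n' \<le> \<phi> (fst (fst m')) * real n"
proof -
  have pos: "0 < snd (fst a)" if a: "a \<in> set (merges r E A P)" for a
  proof -
    obtain J where "J \<subseteq> heads P" "J \<noteq> {}" "snd (fst a) = of_nat (card J)"
      using merges_ok[OF P a] unfolding merge_ok_def by (elim exE conjE) (rule that; blast)
    then show ?thesis
      using finite_heads[OF P] finite_subset by (auto simp: card_gt_0_iff)
  qed
  have "\<not> cheaper m' m"
  proof (rule pick_minimal[of "set (merges r E A P)" cheaper "merges r E A P" m m'])
    fix a b d assume *: "a \<in> set (merges r E A P)" "b \<in> set (merges r E A P)" "d \<in> set (merges r E A P)"
      "\<not> cheaper a b" "cheaper d b"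
    have "(fst (fst d) * snd (fst a)) * snd (fst b) < fst (fst b) * snd (fst d) * snd (fst a)"
      using mult_strict_right_mono[OF *(5)[unfolded cheaper_def] pos[OF *(1)]] by (simp add: ac_simps)
    also have "\<dots> \<le> fst (fst a) * snd (fst b) * snd (fst d)"
      using mult_right_mono[OF *(4)[unfolded cheaper_def not_less] less_imp_le[OF pos[OF *(3)]]] by (simp add: ac_simps)
    finally have "(fst (fst d) * snd (fst a)) * snd (fst b) < (fst (fst a) * snd (fst d)) * snd (fst b)"
      by (simp add: ac_simps)
    then show "\<not> cheaper a d"
      using pos[OF *(2)] unfolding cheaper_def by (simp add: mult_less_cancel_right)
  qed (use m m' in \<open>auto simp: cheaper_def\<close>)
  then have "fst (fst m) * of_nat n' \<le> fst (fst m') * of_nat n"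
    using n unfolding cheaper_def by simp
  then have "\<phi> (fst (fst m) * of_nat n') \<le> \<phi> (fst (fst m') * of_nat n)"
    by (simp add: \<phi>_le)
  then show ?thesis
    by (simp add: \<phi>_mult)
qed


text \<open>The ratio of the picked merge serves as \<open>\<rho>\<close> in
  \<open>density_le_lp\<close>: no threshold merge has a smaller one, and threshold merges realise
  every set \<open>J\<close> in question.\<close>

lemma greedy_density:
  assumes P: "groups_ok P" and m: "pick cheaper (merges r E A P) = [m]"
    and n: "snd (fst m) = of_nat n" "0 < n"
    and x: "lp_feasible G r (set X) x"
  shows "card (heads P) * (\<phi> (fst (fst m)) / n) \<le> 2 * (\<Sum>e\<in>parcs G. c e * x e)"
proof (rule density_le_lp[OF inst qb x heads_subset[OF P], where g = "\<lambda>u. the (map_of P u)" and D = D])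
  have dP: "distinct (map fst P)"
    using P dX unfolding groups_ok_def by simp
  show "the (map_of P j) = j" if "j \<in> insert r (heads P)" for j
  proof -
    have "(j, j) \<in> set P"
      using that P unfolding heads_def groups_ok_def by auto
    then show ?thesis
      using dP by simp
  qed
  show "D j j = Some 0" if "j \<in> heads P" for j
    using that heads_subset[OF P] terminals_in_verts by (intro D_self) auto
  fix u s \<theta> J
  assume us: "(u, s) \<in> parcs G" and u: "u \<in> insert r (set X)" and "J \<noteq> {}"
    and J: "J = {j \<in> heads P. j \<noteq> the (map_of P u) \<and> (\<exists>d\<le>\<theta>. D j s = Some d)}"
  obtain i where i: "(u, i) \<in> set P"
    using u groups_dom[OF P] by force
  then have i': "the (map_of P u) = i"
    using dP by simp
  obtain z where z: "((u, s), z) \<in> set E"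
    using us unfolding arcs by auto
  have fin: "finite J"
    using finite_heads[OF P] unfolding J by auto
  \<comment> \<open>The real number \<open>\<theta>\<close> need not be the value of a label. The
    largest distance in \<open>J\<close> is one, and it cuts out the same set.\<close>
  define y where "y = Max ((\<lambda>j. the (D j s)) ` J)"
  have "y \<in> (\<lambda>j. the (D j s)) ` J"
    using fin \<open>J \<noteq> {}\<close> unfolding y_def by (intro Max_in) auto
  then obtain j where j: "j \<in> J" "D j s = Some y" "y \<le> \<theta>"
    unfolding J by auto
  obtain z' p where z': "(s, z', p) \<in> set (labels V E j)" "y = \<phi> z'"
    using D_label[OF j(2)] by blast
  let ?R = "targets r A P s i"
  let ?J = "filter (\<lambda>a. fst (snd a) \<le> fst (snd (j, z', p))) ?R"
  have b: "(j, z', p) \<in> set ?R"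
    using j(1) z'(1) i' heads_subset[OF P] unfolding in_targets J by auto
  have "fst ` set ?J = {j \<in> heads P. j \<noteq> i \<and> (\<exists>d\<le>y. D j s = Some d)}"
    using threshold_set[OF refl P, where y = z' and s = s and i = i] z'(2) by simp
  also have "\<dots> = J"
  proof (intro equalityI subsetI)
    fix k assume "k \<in> J"
    then show "k \<in> {j \<in> heads P. j \<noteq> i \<and> (\<exists>d\<le>y. D j s = Some d)}"
      using Max_ge[of "(\<lambda>j. the (D j s)) ` J" "the (D k s)"] fin i' unfolding y_def[symmetric] by (auto simp: J)
  qed (use j(3) i' in \<open>auto simp: J\<close>)
  finally have J': "fst ` set ?J = J" .
  have "(j, z', p) \<in> set ?J"
    using b by simp
  then have "?J \<noteq> []"
    by (metis empty_iff empty_set)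
  then have *: "set ?J \<subseteq> set ?R" "distinct (map fst ?J)" "?J \<noteq> []"
    using distinct_targets by (auto simp: distinct_map_filter)
  note ok = merge_of_ok(2,3)[OF P z i *, unfolded J']
  from pick_cheapest[OF P m merges_in[OF z i b] n(1) ok(2)]
  have "\<phi> (fst (fst m)) * real (card J) \<le> (c (u, s) + (\<Sum>j\<in>J. the (D j s))) * real n"
    unfolding ok(1) .
  then show "\<phi> (fst (fst m)) / real n * real (card J) \<le> c (u, s) + (\<Sum>j\<in>J. the (D j s))"
    using n(2) by (simp add: field_simps)
qed (use D_nonneg D_arc D_first in blast)+

text \<open>Heads that are gone pay for the arcs bought so far. The budget starts from
  \<open>length X\<close>, which exceeds the initial number of heads by one if the root is itself a
  terminal.\<close>

definition invar :: "real \<Rightarrow> ('v \<times> 'v) list \<times> 'v path \<Rightarrow> bool" where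
  "invar LP st \<longleftrightarrow> groups_ok (fst st) \<and> set (snd st) \<subseteq> parcs G \<and>
     (\<forall>t i. (t, i) \<in> set (fst st) \<longrightarrow> reach (set (snd st)) i t) \<and>
     len (snd st) \<le> 2 * LP * (harm (length X) - harm (card (heads (fst st))))"

text \<open>With \<open>l\<close> heads left the ratio is at most \<open>2 * LP / l\<close>, so
  absorbing \<open>n\<close> of them costs at most \<open>2 * LP * (n / l)\<close>, within the
  harmonic budget for going from \<open>l\<close> to \<open>l - n\<close>.\<close>

lemma apply_merge_invar:
  assumes inv: "invar (\<Sum>e\<in>parcs G. c e * x e) st" and x: "lp_feasible G r (set X) x"
    and m: "pick cheaper (merges r E A (fst st)) = [m]"
  shows "invar (\<Sum>e\<in>parcs G. c e * x e) (apply_merge m st)"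
    and "card (heads (fst (apply_merge m st))) < card (heads (fst st))"
proof -
  obtain P F where st: "st = (P, F)"
    by (cases st)
  let ?LP = "\<Sum>e\<in>parcs G. c e * x e"
  have P: "groups_ok P" and F: "set F \<subseteq> parcs G" and reach: "\<And>t i. (t, i) \<in> set P \<Longrightarrow> reach (set F) i t"
    and lenF: "len F \<le> 2 * ?LP * (harm (length X) - harm (card (heads P)))"
    using inv unfolding invar_def st by auto
  have "m \<in> set (merges r E A P)"
    using pick_cases[of "merges r E A P" cheaper] m unfolding st by auto
  from merges_ok[OF P this] obtain u s i J where
    us: "(u, s) \<in> parcs G" and ui: "(u, i) \<in> set P" and J: "J \<subseteq> heads P - {i}" "J \<noteq> {}"
    and n: "snd (fst m) = of_nat (card J)"
    and m_i: "fst (fst (snd m)) = i" and m_J: "set (snd (fst (snd m))) = J" and m_len: "len (snd (snd m)) = \<phi> (fst (fst m))"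
    and m_arcs: "set (snd (snd m)) \<subseteq> parcs G" and m_reach: "\<And>j. j \<in> J \<Longrightarrow> reach (set (snd (snd m))) u j"
    unfolding merge_ok_def by (elim exE conjE) (rule that, assumption+, blast)
  let ?P = "map (\<lambda>q. (fst q, if snd q \<in> J then i else snd q)) P"
  have st': "apply_merge m st = (?P, snd (snd m) @ F)"
    unfolding apply_merge_def st m_i m_J by simp
  have finJ: "finite J"
    using J finite_heads[OF P] finite_subset by blast
  have ii: "(i, i) \<in> set P"
    using P ui unfolding groups_ok_def by blast
  have keep: "(j, j) \<in> set ?P" if "(j, j) \<in> set P" "j \<notin> J" for j
    using that by force
  have mem: "\<exists>k. (t, k) \<in> set P \<and> (k \<in> J \<and> j = i \<or> k \<notin> J \<and> j = k)" if "(t, j) \<in> set ?P" for t j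
    using that by (auto split: if_splits)
  have heads': "heads ?P = heads P - J"
  proof (intro equalityI subsetI)
    fix t assume "t \<in> heads ?P"
    then obtain k where k: "(t, k) \<in> set P" "k \<in> J \<and> t = i \<or> k \<notin> J \<and> t = k" "t \<noteq> r"
      using mem[of t t] unfolding heads_def by auto
    \<comment> \<open>Otherwise \<open>t = i\<close> would carry the label \<open>k\<close>; but
      \<open>i\<close> is labelled by itself and lies outside \<open>J\<close>.\<close>
    moreover have "k \<notin> J"
      using k groups_fun[OF P ii, of k] J by auto
    ultimately show "t \<in> heads P - J"
      unfolding heads_def by auto
  next
    show "t \<in> heads ?P" if "t \<in> heads P - J" for t
      using that keep unfolding heads_def by auto
  qed
  have card_le: "card J \<le> card (heads P)" and card': "card (heads ?P) = card (heads P) - card J"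
    and cardJ: "0 < card J"
    using J finJ finite_heads[OF P] unfolding heads' by (auto intro: card_mono card_Diff_subset simp: card_gt_0_iff)
  then show "card (heads (fst (apply_merge m st))) < card (heads (fst st))"
    by (simp add: st'[unfolded st] st)
  have "groups_ok ?P"
    unfolding groups_ok_def
  proof (intro conjI allI impI)
    show "map fst ?P = r # filter (\<lambda>t. t \<noteq> r) X"
      using P unfolding groups_ok_def by (simp add: o_def)
    have "r \<notin> J"
      using J unfolding heads_def by auto
    then show "(r, r) \<in> set ?P"
      using P unfolding groups_ok_def by (intro keep) auto
    show "(j, j) \<in> set ?P" if "(t, j) \<in> set ?P" for t j
      using mem[OF that] keep ii J P unfolding groups_ok_def by blast
  qed
  moreover have "reach (set (snd (snd m) @ F)) j t" if tj: "(t, j) \<in> set ?P" for t j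
  proof -
    obtain k where k: "(t, k) \<in> set P" "k \<in> J \<and> j = i \<or> k \<notin> J \<and> j = k"
      using mem[OF tj] by blast
    have "reach (set (snd (snd m) @ F)) k t"
      using reach[OF k(1)] by (rule reach_mono) auto
    moreover have "reach (set (snd (snd m) @ F)) i k" if "k \<in> J"
    proof (rule reach_trans)
      show "reach (set (snd (snd m) @ F)) i u"
        using reach[OF ui] by (rule reach_mono) auto
      show "reach (set (snd (snd m) @ F)) u k"
        using m_reach[OF that] by (rule reach_mono) auto
    qed
    ultimately show ?thesis
      using k(2) reach_trans by metis
  qed
  moreover have "len (snd (snd m) @ F) \<le> 2 * ?LP * (harm (length X) - harm (card (heads ?P)))"
  proof -
    have LP: "0 \<le> ?LP"
      using x by (intro sum_nonneg mult_nonneg_nonneg cost_nonneg) (auto simp: lp_feasible_def)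
    have h: "0 < card (heads P)"
      using card_le cardJ by linarith
    have "card (heads P) * (\<phi> (fst (fst m)) / card J) \<le> 2 * ?LP"
      using greedy_density[OF P _ n cardJ x] m unfolding st by simp
    then have "\<phi> (fst (fst m)) \<le> 2 * ?LP * (card J / card (heads P))"
      using h cardJ by (simp add: field_simps)
    also have "\<dots> \<le> 2 * ?LP * (harm (card (heads P)) - harm (card (heads P) - card J))"
      using LP card_div_le_harm_diff[OF card_le] by (intro mult_left_mono) auto
    finally have "len (snd (snd m)) \<le> 2 * ?LP * (harm (card (heads P)) - harm (card (heads P) - card J))"
      unfolding m_len .
    then show ?thesis
      using lenF unfolding card' by (simp add: algebra_simps)
  qed
  ultimately show "invar ?LP (apply_merge m st)"
    using F m_arcs unfolding invar_def st' by simp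
qed

text \<open>The first arc of a shortest path from the root to a remaining head starts a merge into
  the root's group, so the greedy process never gets stuck.\<close>

lemma merges_nonempty:
  assumes P: "groups_ok P" and "heads P \<noteq> {}" and reachable: "\<And>t. t \<in> set X \<Longrightarrow> \<exists>p. walk r p t"
  shows "merges r E A P \<noteq> []"
proof -
  obtain j where j: "j \<in> heads P" "j \<in> set X" "j \<noteq> r"
    using assms(2) heads_subset[OF P] by blast
  obtain p where "walk r p j"
    using reachable[OF j(2)] by blast
  then obtain d where "D j r = Some d"
    using D_le_len root_in_verts by blast
  with j(3) obtain v d' where v: "(r, v) \<in> parcs G" "D j v = Some d'"
    using D_first by blast
  then obtain z where z: "((r, v), z) \<in> set E"
    unfolding arcs by auto
  obtain z' p' where "(v, z', p') \<in> set (labels V E j)"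
    using D_label[OF v(2)] by blast
  then have "(j, z', p') \<in> set (targets r A P v r)"
    using j unfolding in_targets by simp
  from merges_in[OF z _ this] show ?thesis
    using P unfolding groups_ok_def by force
qed

theorem greedy_tree_correct:
  fixes F defines "F \<equiv> greedy_tree V E r X"
  assumes reachable: "\<And>t. t \<in> set X \<Longrightarrow> \<exists>p. walk r p t" and x: "lp_feasible G r (set X) x"
  shows "set F \<subseteq> parcs G" "t \<in> set X \<Longrightarrow> reach (set F) r t"
    and "(\<Sum>e\<in>set F. c e) \<le> 2 * harm (card (set X)) * (\<Sum>e\<in>parcs G. c e * x e)"
proof -
  let ?LP = "\<Sum>e\<in>parcs G. c e * x e"
  let ?st = "\<lambda>xs :: 'v list. fold (\<lambda>_ st. greedy_step r E A st) xs (init_groups r X, [])"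
  have LP: "0 \<le> ?LP"
    using x by (intro sum_nonneg mult_nonneg_nonneg cost_nonneg) (auto simp: lp_feasible_def)
  have init: "groups_ok (init_groups r X)" "card (heads (init_groups r X)) \<le> length X"
  proof -
    show "groups_ok (init_groups r X)"
      unfolding groups_ok_def init_groups_def by (auto simp: o_def)
    have "heads (init_groups r X) \<subseteq> set X"
      unfolding heads_def init_groups_def by auto
    then show "card (heads (init_groups r X)) \<le> length X"
      by (meson List.finite_set card_length card_mono le_trans)
  qed
  have "invar ?LP (?st xs) \<and> card (heads (fst (?st xs))) \<le> length X - length xs" for xs
  proof (induction xs rule: rev_induct)
    case Nil
    have "harm (card (heads (init_groups r X))) \<le> (harm (length X) :: real)"
      using init(2) by (rule harm_mono)
    then show ?case
      using init LP unfolding invar_def by (auto simp: init_groups_def reach_refl)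
  next
    case (snoc y xs)
    then have inv: "invar ?LP (?st xs)" and card: "card (heads (fst (?st xs))) \<le> length X - length xs"
      by auto
    have st_step: "?st (xs @ [y]) = greedy_step r E A (?st xs)"
      by simp
    show ?case
    proof (cases "pick cheaper (merges r E A (fst (?st xs))) = []")
      case True
      \<comment> \<open>Candidates run out only when no head is left; the remaining rounds then do
        nothing.\<close>
      then have "merges r E A (fst (?st xs)) = []"
        using pick_cases[of "merges r E A (fst (?st xs))" cheaper] by auto
      then have "heads (fst (?st xs)) = {}"
        using merges_nonempty reachable inv unfolding invar_def by blast
      then show ?thesis
        using inv True unfolding st_step greedy_step_def by simp
    next
      case False
      then obtain m where m: "pick cheaper (merges r E A (fst (?st xs))) = [m]"
        using pick_cases[of "merges r E A (fst (?st xs))" cheaper] by auto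
      then show ?thesis
        using apply_merge_invar[OF inv x m] card unfolding st_step greedy_step_def by auto
    qed
  qed
  from this[of X] have inv: "invar ?LP (?st X)" and "card (heads (fst (?st X))) = 0"
    by auto
  then have h: "heads (fst (?st X)) = {}"
    using finite_heads unfolding invar_def by auto
  have F: "F = snd (?st X)"
    unfolding F_def greedy_tree_def ..
  show "set F \<subseteq> parcs G"
    using inv unfolding invar_def F by blast
  show "reach (set F) r t" if t: "t \<in> set X"
  proof -
    have "t \<in> fst ` set (fst (?st X))"
      using groups_dom[of "fst (?st X)"] t inv unfolding invar_def by blast
    then obtain i where i: "(t, i) \<in> set (fst (?st X))"
      by auto
    moreover have "(i, i) \<in> set (fst (?st X))"
      using i inv unfolding invar_def groups_ok_def by blast
    then have "i = r"
      using h unfolding heads_def by auto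
    ultimately show ?thesis
      using inv unfolding invar_def F by blast
  qed
  \<comment> \<open>An arc may be bought repeatedly; the list counts every purchase, the set only
    one.\<close>
  have "(\<Sum>e\<in>set F. c e) \<le> len F"
  proof -
    have "(\<Sum>e\<in>set F'. c e) \<le> len F'" if "set F' \<subseteq> parcs G" for F'
      using that by (induction F') (auto simp: sum.insert_if intro: cost_nonneg add_increasing)
    then show ?thesis
      using \<open>set F \<subseteq> parcs G\<close> by blast
  qed
  also have "len F \<le> 2 * ?LP * harm (length X)"
    using inv h unfolding invar_def F by (simp add: harm_expand)
  finally show "(\<Sum>e\<in>set F. c e) \<le> 2 * harm (card (set X)) * ?LP"
    using distinct_card[OF dX] by (simp add: ac_simps)
qed

end

section \<open>The greedy algorithm in polynomial time\<close>

text \<open>\<open>hd []\<close> is some fixed but unspecified value. Totality demands that the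
  program output it too, which a constant program does.\<close>

lemma poly_time_hd [poly_time_intros]:
  fixes l :: "'a :: encodable \<Rightarrow> 'b :: encodable list"
  assumes "poly_time l"
  shows "poly_time (\<lambda>x. hd (l x))"
proof (rule poly_time_comp[OF _ assms])
  obtain P m where P: "\<And>xs :: 'b list. runs P (encode xs) (encode (hd ([] :: 'b list))) (m xs)" and m: "poly_bounded m"
    using poly_time_const[of "hd ([] :: 'b list)"] by (rule poly_timeE) blast
  obtain Q n where Q: "\<And>xs :: 'b list. runs Q (encode xs) (encode (xs = [])) (n xs)" and n: "poly_bounded n"
    using poly_time_null[OF poly_time_id] by (rule poly_timeE) blast
  have "runs (Cond Q P Left) (encode xs) (encode (hd xs)) (n xs + (m xs + 2 * sz xs) + sz xs)" for xs :: "'b list"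
  proof (rule runs_Cond)
    show "runs Q (encode xs) (of_truth (xs = [])) (n xs)"
      using Q[of xs] by simp
    show "runs (if xs = [] then P else Left) (encode xs) (encode (hd xs)) (m xs + 2 * sz xs)"
    proof (cases xs)
      case Nil
      then show ?thesis
        using runs_le[OF P[of "[]"]] by simp
    next
      case (Cons y ys)
      then show ?thesis
        using runs_le[OF runs_step[OF step.intros(3)[of "encode y" "encode ys"]]] by simp
    qed
  qed
  then show "poly_time (hd :: 'b list \<Rightarrow> 'b)"
    by (rule poly_timeI) (intro poly_bounded_intros poly_bounded_sz_id m n)
qed

text \<open>Inside a traversal the argument becomes a pair of environment and entry; composing the
  assumptions with projections makes \<open>E\<close>, \<open>h\<close>, \<open>T\<close> and
  \<open>v\<close> available there.\<close>

lemma poly_time_label_cands [poly_time_intros]: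
  fixes E :: "'a :: encodable \<Rightarrow> (nat, int) weighted_arcs"
  assumes "poly_time E" "poly_time h" "poly_time T" "poly_time v"
  shows "poly_time (\<lambda>x. label_cands (E x) 0 (h x) (T x) (v x))"
  unfolding label_cands_def by (intro poly_time_intros assms assms[THEN poly_time_comp])

lemma poly_time_label_round [poly_time_intros]:
  fixes E :: "'a :: encodable \<Rightarrow> (nat, int) weighted_arcs"
  assumes "poly_time V" "poly_time E" "poly_time h" "poly_time T"
  shows "poly_time (\<lambda>x. label_round (V x) (E x) (h x) (T x))"
  unfolding label_round_def by (intro poly_time_intros assms assms[THEN poly_time_comp])

text \<open>A round extends each path by one arc and adds one cost, so labels grow additively and do
  not double. The least \<open>b\<close> allowed, 3, is the size of the empty path's label
  \<open>(0, [])\<close>.\<close>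

lemma sz_label_round:
  fixes E :: "(nat, int) weighted_arcs"
  assumes "\<forall>l\<in>set T. sz (snd l) \<le> b" "3 \<le> b"
  shows "length (label_round V E h T) \<le> length V"
    and "\<forall>l\<in>set (label_round V E h T). fst l \<in> set V \<and> sz (snd l) \<le> b + sz E"
proof -
  have cand: "sz a \<le> b + sz E" if "a \<in> set (label_cands E 0 h T v)" for a v
  proof -
    obtain z p where a: "a = (z, p)"
      by (cases a)
    show ?thesis
    proof (cases "v = h \<and> z = 0 \<and> p = []")
      case True
      then show ?thesis
        using assms(2) a by (simp add: floorlog_def)
    next
      case False
      then obtain u y z' p' where *: "((v, u), y) \<in> set E" "(u, z', p') \<in> set T" "z = y + z'" "p = (v, u) # p'"
        using \<open>a \<in> _\<close> unfolding a label_cands_iff by blast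
      have "sz (z', p') \<le> b" "sz ((v, u), y) \<le> sz E"
        using assms(1) *(2) sz_elem_le[OF *(1)] by auto
      then show ?thesis
        using sz_add_le[of y z'] unfolding a *(3,4) by simp
    qed
  qed
  have pick: "set (pick (\<lambda>a b. fst a < fst b) xs) \<subseteq> set xs" "length (pick (\<lambda>a b. fst a < fst b) xs) \<le> 1"
    for xs :: "(int \<times> nat path) list"
    using pick_cases[of xs "\<lambda>a b. fst a < fst b"] by auto
  have "length (concat (map f xs)) \<le> length xs" if "\<And>x. length (f x) \<le> 1" for f :: "nat \<Rightarrow> (nat \<times> int \<times> nat path) list" and xs
    using that by (induction xs) (auto simp: add_le_mono[of _ 1, simplified])
  then show "length (label_round V E h T) \<le> length V"
    unfolding label_round_def using pick(2) by simp
  show "\<forall>l\<in>set (label_round V E h T). fst l \<in> set V \<and> sz (snd l) \<le> b + sz E"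
    using cand pick(1) unfolding label_round_def by fastforce
qed

lemma poly_time_labels [poly_time_intros]:
  fixes E :: "'a :: encodable \<Rightarrow> (nat, int) weighted_arcs"
  assumes "poly_time V" "poly_time E" "poly_time h"
  shows "poly_time (\<lambda>x. labels (V x) (E x) (h x))"
  unfolding labels_def
proof (rule poly_time_fold)
  let ?B = "\<lambda>x. 1 + sz (V x) * (5 + sz (V x) + sz (V x) * sz (E x))"
  let ?T = "\<lambda>x xs. fold (\<lambda>_. label_round (V x) (E x) (h x)) xs []"
  show "poly_bounded ?B"
    by (intro poly_bounded_intros assms)
  have inv: "length (?T x xs) \<le> length (V x) \<and>
      (\<forall>l\<in>set (?T x xs). fst l \<in> set (V x) \<and> sz (snd l) \<le> 3 + length xs * sz (E x))" for x and xs :: "nat list"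
  proof (induction xs rule: rev_induct)
    case (snoc y xs)
    then show ?case
      using sz_label_round[of "?T x xs" "3 + length xs * sz (E x)" "V x" "E x" "h x"] by (auto simp: algebra_simps)
  qed auto
  show "sz (fold (\<lambda>_. label_round (V x) (E x) (h x)) (take n (V x)) []) \<le> ?B x" for x n
  proof -
    let ?xs = "take n (V x)"
    have len: "length ?xs \<le> sz (V x)"
      using length_le_sz[of "V x"] by simp
    have "sz l \<le> 4 + sz (V x) + sz (V x) * sz (E x)" if "l \<in> set (?T x ?xs)" for l
    proof -
      have "sz (fst l) \<le> sz (V x)" "sz (snd l) \<le> 3 + length ?xs * sz (E x)"
        using inv[of x ?xs] that sz_elem_le by blast+
      moreover have "length ?xs * sz (E x) \<le> sz (V x) * sz (E x)"
        using len by (rule mult_le_mono1)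
      ultimately show ?thesis
        unfolding encode_prod_def data_size.simps by linarith
    qed
    then have "sz (?T x ?xs) \<le> 1 + length (?T x ?xs) * (4 + sz (V x) + sz (V x) * sz (E x) + 1)"
      by (rule sz_list_le)
    also have "\<dots> \<le> 1 + sz (V x) * (4 + sz (V x) + sz (V x) * sz (E x) + 1)"
      using inv[of x ?xs] length_le_sz[of "V x"] by (intro add_left_mono mult_le_mono1) linarith
    finally show ?thesis
      by (simp add: add_ac)
  qed
qed (intro poly_time_intros assms assms[THEN poly_time_comp])+

lemma poly_time_label_table [poly_time_intros]:
  fixes E :: "'a :: encodable \<Rightarrow> (nat, int) weighted_arcs"
  assumes "poly_time V" "poly_time E" "poly_time X"
  shows "poly_time (\<lambda>x. label_table (V x) (E x) (X x))"
  unfolding label_table_def by (intro poly_time_intros assms assms[THEN poly_time_comp])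

lemma poly_time_targets [poly_time_intros]:
  fixes A :: "'a :: encodable \<Rightarrow> (nat \<times> (nat, int) path_labels) list"
  assumes "poly_time r" "poly_time A" "poly_time P" "poly_time s" "poly_time i"
  shows "poly_time (\<lambda>x. targets (r x) (A x) (P x) (s x) (i x))"
  unfolding targets_def by (intro poly_time_intros assms assms[THEN poly_time_comp])

lemma poly_time_merge_of [poly_time_intros]:
  fixes J :: "'a :: encodable \<Rightarrow> (nat, int) path_labels"
  assumes "poly_time e" "poly_time i" "poly_time J"
  shows "poly_time (\<lambda>x. merge_of (e x) (i x) (J x))"
  unfolding merge_of_def by (intro poly_time_intros assms assms[THEN poly_time_comp])

lemma poly_time_threshold_merges [poly_time_intros]:
  fixes R :: "'a :: encodable \<Rightarrow> (nat, int) path_labels"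
  assumes "poly_time e" "poly_time i" "poly_time R"
  shows "poly_time (\<lambda>x. threshold_merges (e x) (i x) (R x))"
  unfolding threshold_merges_def by (intro poly_time_intros assms assms[THEN poly_time_comp])

lemma poly_time_merges [poly_time_intros]:
  fixes E :: "'a :: encodable \<Rightarrow> (nat, int) weighted_arcs"
  assumes "poly_time r" "poly_time E" "poly_time A" "poly_time P"
  shows "poly_time (\<lambda>x. merges (r x) (E x) (A x) (P x))"
  unfolding merges_def by (intro poly_time_intros assms assms[THEN poly_time_comp])

lemma poly_time_cheaper [poly_time_intros]:
  fixes a b :: "'a :: encodable \<Rightarrow> (nat, int) merge"
  assumes "poly_time a" "poly_time b"
  shows "poly_time (\<lambda>x. cheaper (a x) (b x))"
  unfolding cheaper_def by (intro poly_time_intros assms)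

lemma poly_time_apply_merge [poly_time_intros]:
  fixes m :: "'a :: encodable \<Rightarrow> (nat, int) merge"
  assumes "poly_time m" "poly_time st"
  shows "poly_time (\<lambda>x. apply_merge (m x) (st x))"
  unfolding apply_merge_def by (intro poly_time_intros assms assms[THEN poly_time_comp])

lemma poly_time_greedy_step [poly_time_intros]:
  fixes E :: "'a :: encodable \<Rightarrow> (nat, int) weighted_arcs"
  assumes "poly_time r" "poly_time E" "poly_time A" "poly_time st"
  shows "poly_time (\<lambda>x. greedy_step (r x) (E x) (A x) (st x))"
  unfolding greedy_step_def by (intro poly_time_intros assms assms[THEN poly_time_comp])

lemma poly_time_init_groups [poly_time_intros]:
  fixes r :: "'a :: encodable \<Rightarrow> nat"
  assumes "poly_time r" "poly_time X"
  shows "poly_time (\<lambda>x. init_groups (r x) (X x))"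
  unfolding init_groups_def by (intro poly_time_intros assms assms[THEN poly_time_comp])

text \<open>Merging introduces no new labels, which bounds the size of the group table. No validity
  of the input is assumed, since \<open>poly_time\<close> bounds the cost on every argument.\<close>

lemma merge_label: "m \<in> set (merges r E A P) \<Longrightarrow> fst (fst (snd m)) \<in> snd ` set P"
  unfolding merges_def threshold_merges_def merge_of_def
  by (auto simp: image_def Bex_def split: if_splits) blast

text \<open>The candidate merges depend on the group table but not on the arcs bought so far. As the
  table keeps its length and its supply of labels, each round appends arcs of total size at most the
  fixed amount \<open>K x\<close>, and the bought list grows linearly in the number of
  rounds.\<close>

lemma poly_time_greedy_tree [poly_time_intros]:
  fixes E :: "'a :: encodable \<Rightarrow> (nat, int) weighted_arcs"
  assumes "poly_time V" "poly_time E" "poly_time r" "poly_time X"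
  shows "poly_time (\<lambda>x. greedy_tree (V x) (E x) (r x) (X x))"
proof -
  define A where "A x = label_table (V x) (E x) (X x)" for x
  let ?st = "\<lambda>x xs. fold (\<lambda>_. greedy_step (r x) (E x) (A x)) xs (init_groups (r x) (X x), [])"
  have A: "poly_time A"
    unfolding A_def by (intro poly_time_intros assms)
  have "poly_time (\<lambda>z :: nat \<times> (nat, int) weighted_arcs \<times> (nat \<times> (nat, int) path_labels) list \<times> (nat \<times> nat) list.
      merges (fst z) (fst (snd z)) (fst (snd (snd z))) (snd (snd (snd z))))"
    by (intro poly_time_intros)
  from poly_bounded_sz[OF this] obtain p where
    p: "\<And>r E A P. sz (merges r E A P :: (nat, int) merge list) \<le> poly p (sz (r, E, A, P))"
    unfolding poly_bounded_def by (metis fst_conv snd_conv)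
  define BP where "BP x = 1 + (sz (X x) + 1) * (2 * (sz (r x) + sz (X x)) + 2)" for x
  define K where "K x = poly p (sz (r x, E x, A x) + BP x + 1)" for x
  define ok where "ok x P \<longleftrightarrow> length P \<le> length (X x) + 1 \<and> fst ` set P \<union> snd ` set P \<subseteq> insert (r x) (set (X x))"
    for x and P :: "(nat \<times> nat) list"
  have sz_ok: "sz P \<le> BP x" if "ok x P" for x P
  proof -
    have "sz q \<le> 2 * (sz (r x) + sz (X x)) + 1" if "q \<in> set P" for q
    proof -
      have "t \<in> insert (r x) (set (X x)) \<Longrightarrow> sz t \<le> sz (r x) + sz (X x)" for t
        using sz_elem_le[of t "X x"] by auto
      then have "sz (fst q) \<le> sz (r x) + sz (X x)" "sz (snd q) \<le> sz (r x) + sz (X x)"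
        using \<open>ok x P\<close> \<open>q \<in> set P\<close> unfolding ok_def by blast+
      then show ?thesis
        by simp
    qed
    then have "sz P \<le> 1 + length P * (2 * (sz (r x) + sz (X x)) + 1 + 1)"
      by (rule sz_list_le)
    also have "\<dots> \<le> 1 + (sz (X x) + 1) * (2 * (sz (r x) + sz (X x)) + 1 + 1)"
      using \<open>ok x P\<close> length_le_sz[of "X x"] unfolding ok_def by (intro add_left_mono mult_le_mono1) linarith
    also have "\<dots> = BP x"
      unfolding BP_def by simp
    finally show ?thesis .
  qed
  have inv: "ok x (fst (?st x xs)) \<and> sz (snd (?st x xs)) \<le> 1 + length xs * K x" for x and xs :: "nat list"
  proof (induction xs rule: rev_induct)
    case Nil
    then show ?case
      by (auto simp: ok_def init_groups_def floorlog_def le_SucI)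
  next
    case (snoc y xs)
    let ?s = "?st x xs"
    let ?M = "merges (r x) (E x) (A x) (fst ?s)"
    have st: "?st x (xs @ [y]) = greedy_step (r x) (E x) (A x) ?s"
      by simp
    show ?case
    proof (cases "pick cheaper ?M = []")
      case True
      then show ?thesis
        using snoc unfolding st greedy_step_def by simp
    next
      case False
      then obtain m where m: "m \<in> set ?M" "pick cheaper ?M = [m]"
        using pick_cases[of ?M cheaper] by auto
      then have st': "?st x (xs @ [y]) = apply_merge m ?s"
        unfolding st greedy_step_def by simp
      have "ok x (fst (apply_merge m ?s))"
      proof -
        have "fst ` set (fst (apply_merge m ?s)) = fst ` set (fst ?s)"
          "snd ` set (fst (apply_merge m ?s)) \<subseteq> snd ` set (fst ?s)"
          using merge_label[OF m(1)] unfolding apply_merge_def by (auto simp: image_image)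
        moreover have "length (fst (apply_merge m ?s)) = length (fst ?s)"
          unfolding apply_merge_def by simp
        ultimately show ?thesis
          using conjunct1[OF snoc.IH] unfolding ok_def by (intro conjI) (simp, blast)
      qed
      moreover have "sz (snd (apply_merge m ?s)) \<le> 1 + length (xs @ [y]) * K x"
      proof -
        have "sz (snd (snd m)) \<le> sz ?M"
          using sz_elem_le[OF m(1)] by simp
        also have "\<dots> \<le> poly p (sz (r x, E x, A x, fst ?s))"
          by (rule p)
        also have "\<dots> \<le> K x"
          unfolding K_def using sz_ok[of x "fst ?s"] snoc by (intro poly_nat_mono) simp
        finally have "sz (snd (snd m)) \<le> K x" .
        then show ?thesis
          using sz_append[of "snd (snd m)" "snd ?s"] snoc unfolding apply_merge_def by simp
      qed
      ultimately show ?thesis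
        unfolding st' by blast
    qed
  qed
  let ?B = "\<lambda>x. 2 + BP x + sz (X x) * K x"
  have "poly_time (\<lambda>x. ?st x (X x))"
  proof (rule poly_time_fold[where B = ?B])
    show "poly_bounded ?B"
      unfolding BP_def K_def by (intro poly_bounded_intros poly_bounded_poly poly_bounded_sz poly_time_intros assms A)
    show "sz (?st x (take n (X x))) \<le> ?B x" for x n
    proof -
      have "length (take n (X x)) * K x \<le> sz (X x) * K x"
        using length_le_sz[of "X x"] by (intro mult_le_mono1) simp
      then show ?thesis
        using conjunct2[OF inv, of x "take n (X x)"] sz_ok[OF conjunct1[OF inv], of x "take n (X x)"]
        unfolding encode_prod_def data_size.simps by linarith
    qed
  qed (intro poly_time_intros assms A assms[THEN poly_time_comp] A[THEN poly_time_comp])+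
  then show ?thesis
    unfolding greedy_tree_def A_def by (rule poly_time_snd)
qed

text \<open>A product instead of a least common multiple: its bit length is still at most the sum of
  those of the factors, and no gcd has to be computed.\<close>

definition denominator :: "('v \<times> int \<times> int) list \<Rightarrow> int" where
  "denominator es = prod_list (map (\<lambda>e. snd (snd e)) es)"

definition scale_costs :: "('v \<times> int \<times> int) list \<Rightarrow> ('v \<times> int) list" where
  "scale_costs es = map (\<lambda>e. (fst e, fst (snd e) * (denominator es div snd (snd e)))) es"

lemma poly_time_scale_costs [poly_time_intros]:
  fixes es :: "'a :: encodable \<Rightarrow> ('b :: encodable \<times> int \<times> int) list"
  assumes "poly_time es"
  shows "poly_time (\<lambda>x. scale_costs (es x))"
  unfolding scale_costs_def denominator_def by (intro poly_time_intros assms assms[THEN poly_time_comp])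

lemma scale_quotient_of:
  fixes q :: "'v \<Rightarrow> rat" and xs :: "'v list"
  defines "es \<equiv> map (\<lambda>e. (e, quotient_of (q e))) xs"
  shows "0 < denominator es" "fst ` set (scale_costs es) = set xs"
    and "(e, z) \<in> set (scale_costs es) \<Longrightarrow> of_int z / of_int (denominator es) = real_of_rat (q e)"
proof -
  have pos: "0 < snd (snd e)" if "e \<in> set es" for e
    using that quotient_of_denom_pos' unfolding es_def by auto
  then show D: "0 < denominator es"
    unfolding denominator_def by (induction es) auto
  show "fst ` set (scale_costs es) = set xs"
    unfolding scale_costs_def es_def by (auto simp: image_image)
  assume "(e, z) \<in> set (scale_costs es)"
  then obtain a b where e: "(e, a, b) \<in> set es" "z = a * (denominator es div b)"
    unfolding scale_costs_def by auto
  then have "quotient_of (q e) = (a, b)"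
    unfolding es_def by auto
  then have q: "q e = of_int a / of_int b"
    by (rule quotient_of_div)
  have "b \<in> set (map (\<lambda>e. snd (snd e)) es)"
    using e(1) by force
  then have b: "b dvd denominator es" "0 < b"
    using pos[OF e(1)] prod_list_dvd unfolding denominator_def by (blast, simp)
  then have "real_of_int (denominator es div b) = of_int (denominator es) / of_int b"
    by (simp add: real_of_int_div)
  then show "of_int z / of_int (denominator es) = real_of_rat (q e)"
    using D b(2) unfolding e(2) q by (simp add: of_rat_divide)
qed

section \<open>Feasibility and the integrality gap\<close>

lemma walk_crosses: "pcas u p v \<Longrightarrow> u \<notin> S \<Longrightarrow> v \<in> S \<Longrightarrow> \<exists>e\<in>set p. fst e \<notin> S \<and> snd e \<in> S"
  by (induction u p v rule: pcas.induct) auto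

text \<open>If \<open>t\<close> is unreachable, no arc enters the set of vertices that reach
  \<open>t\<close>, and its cut constraint fails. Conversely a walk from the root crosses every cut,
  so the all-ones vector is feasible.\<close>

lemma lp_feasible_iff_reachable:
  assumes "dst_instance G c r X"
  shows "(\<exists>x. lp_feasible G r X x) \<longleftrightarrow> (\<forall>t\<in>X. reach (parcs G) r t)"
proof
  interpret dst_instance G c r X by fact
  assume "\<exists>x. lp_feasible G r X x"
  then obtain x where x: "lp_feasible G r X x" ..
  show "\<forall>t\<in>X. reach (parcs G) r t"
  proof (rule ballI, rule ccontr)
    fix t assume t: "t \<in> X" "\<not> reach (parcs G) r t"
    define S where "S = {v \<in> pverts G. reach (parcs G) v t}"
    have "delta_in G S = {}"
      unfolding delta_in_def S_def using reach_arc[of _ _ "parcs G"] reach_trans in_arcsD1 by fastforce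
    moreover have "t \<in> S" "r \<notin> S"
      using t terminals_in_verts reach_refl unfolding S_def by auto
    then have "S \<subseteq> pverts G - {r}" "S \<inter> X \<noteq> {}"
      using t(1) unfolding S_def by auto
    ultimately show False
      using x unfolding lp_feasible_def by (metis not_one_le_zero sum.empty)
  qed
next
  interpret dst_instance G c r X by fact
  assume R: "\<forall>t\<in>X. reach (parcs G) r t"
  have "lp_feasible G r X (\<lambda>e. 1)"
    unfolding lp_feasible_def
  proof (intro conjI allI impI)
    fix S assume S: "S \<subseteq> pverts G - {r} \<and> S \<inter> X \<noteq> {}"
    then obtain t p where p: "t \<in> S" "set p \<subseteq> parcs G" "pcas r p t"
      using R unfolding reach_def by blast
    have "\<exists>e\<in>set p. fst e \<notin> S \<and> snd e \<in> S"
      using S p by (intro walk_crosses[of r p t S]) auto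
    then obtain e where "e \<in> parcs G" "fst e \<notin> S" "snd e \<in> S"
      using p(2) by blast
    then have "delta_in G S \<noteq> {}"
      unfolding delta_in_def by (cases e) auto
    moreover have "finite (delta_in G S)"
      using pair_finite_arcs by (rule finite_subset[rotated]) (auto simp: delta_in_def)
    ultimately show "1 \<le> (\<Sum>e\<in>delta_in G S. 1 :: real)"
      by (simp add: Suc_leI card_gt_0_iff)
  qed auto
  then show "\<exists>x. lp_feasible G r X x"
    by (rule exI[of _ "\<lambda>e. 1"])
qed

lemma directed_steiner_tree_iff:
  assumes "dst_instance G c r X"
  shows "directed_steiner_tree G r X F \<longleftrightarrow> F \<subseteq> parcs G \<and> (\<forall>t\<in>X. reach F r t)"
proof (cases "F \<subseteq> parcs G")
  case True
  interpret dst_instance G c r X by fact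
  let ?H = "\<lparr>pverts = pverts G, parcs = F\<rparr>"
  interpret H: pair_wf_digraph ?H
    by unfold_locales (auto dest!: subsetD[OF True] dest: in_arcsD1 in_arcsD2)
  have "(\<exists>p. H.apath r p t) \<longleftrightarrow> reach F r t" for t
  proof
    assume "\<exists>p. H.apath r p t"
    then show "reach F r t"
      unfolding H.apath_def H.awalk_def reach_def by auto
  next
    assume "reach F r t"
    then obtain p where "H.awalk r p t"
      using root_in_verts unfolding H.awalk_def reach_def by auto
    then show "\<exists>p. H.apath r p t"
      using H.apath_awalk_to_apath by blast
  qed
  then show ?thesis
    unfolding directed_steiner_tree_def by simp
qed (auto simp: directed_steiner_tree_def)

text \<open>The bound for each \<open>x\<close> passes to the infimum after division by the factor.
  Without terminals the factor is 0, and the feasible zero vector gives \<open>s \<le> 0\<close>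
  directly.\<close>

lemma ereal_le_mult_opt_lp:
  assumes "dst_instance G c r X"
    and le: "\<And>x. lp_feasible G r X x \<Longrightarrow> s \<le> 2 * harm (card X) * (\<Sum>e\<in>parcs G. c e * x e)"
  shows "ereal s \<le> ereal (2 * harm (card X)) * opt_lp G c r X"
proof (cases "card X = 0")
  case True
  interpret dst_instance G c r X by fact
  have "X = {}"
    using True terminals_in_verts pair_finite_verts finite_subset by fastforce
  then have "s \<le> 0"
    using le[of "\<lambda>e. 0"] by (simp add: lp_feasible_def)
  then show ?thesis
    using True by (simp add: harm_expand flip: zero_ereal_def)
next
  case False
  define a where "a = 2 * (harm (card X) :: real)"
  have a: "0 < a"
    using False unfolding a_def by simp
  have "ereal (s / a) \<le> opt_lp G c r X"
    unfolding opt_lp_def using le[folded a_def] a by (intro INF_greatest) (auto simp: pos_divide_le_eq mult.commute)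
  then have "ereal a * ereal (s / a) \<le> ereal a * opt_lp G c r X"
    using a by (intro ereal_mult_left_mono) auto
  then show ?thesis
    using a unfolding a_def by simp
qed

lemma (in greedy_input) greedy_tree_steiner:
  assumes "\<forall>t\<in>set X. reach (parcs G) r t"
  shows "directed_steiner_tree G r (set X) (set (greedy_tree V E r X))"
    and "ereal (\<Sum>e\<in>set (greedy_tree V E r X). c e) \<le> ereal (2 * harm (card (set X))) * opt_lp G c r (set X)"
proof -
  have walks: "\<exists>p. walk r p t" if "t \<in> set X" for t
    using assms that unfolding reach_def walk_def by blast
  obtain x where x: "lp_feasible G r (set X) x"
    using assms lp_feasible_iff_reachable[OF inst] by blast
  show "directed_steiner_tree G r (set X) (set (greedy_tree V E r X))"
    unfolding directed_steiner_tree_iff[OF inst] using greedy_tree_correct(1,2)[OF walks x] by blast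
  show "ereal (\<Sum>e\<in>set (greedy_tree V E r X). c e) \<le> ereal (2 * harm (card (set X))) * opt_lp G c r (set X)"
    by (intro ereal_le_mult_opt_lp[OF inst] greedy_tree_correct(3)[OF walks])
qed

lemma integrality_gap:
  assumes inst: "dst_instance G c r X" and qb: "quasi_bipartite G r X"
  shows "opt_dst G c r X \<le> ereal (2 * harm (card X)) * opt_lp G c r X"
proof (cases "\<forall>t\<in>X. reach (parcs G) r t")
  case True
  interpret dst_instance G c r X by fact
  obtain V where V: "set V = pverts G" "distinct V"
    using finite_distinct_list[OF pair_finite_verts] by blast
  obtain X' where X': "set X' = X" "distinct X'"
    using finite_distinct_list[of X] finite_subset[OF terminals_in_verts pair_finite_verts] by blast
  obtain E where E: "set E = parcs G"
    using finite_list[OF pair_finite_arcs] by blast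
  interpret greedy_input G c r X' V "map (\<lambda>e. (e, c e)) E" "\<lambda>z. z"
    by (rule greedy_input.intro) (use inst qb V X' E in \<open>auto simp: image_image\<close>)
  note tree = greedy_tree_steiner[unfolded X'(1), OF True]
  have "opt_dst G c r X \<le> ereal (\<Sum>e\<in>set (greedy_tree V (map (\<lambda>e. (e, c e)) E) r X'). c e)"
    unfolding opt_dst_def using tree(1) by (intro INF_lower) simp
  then show ?thesis
    using tree(2) by (rule order_trans)
next
  case False
  interpret dst_instance G c r X by fact
  have "{x. lp_feasible G r X x} = {}"
    using False lp_feasible_iff_reachable[OF inst] by blast
  then have "opt_lp G c r X = \<infinity>"
    unfolding opt_lp_def by (simp only:) (simp add: top_ereal_def)
  \<comment> \<open>The factor must be shown positive, since 0 times infinity is 0 in the extended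
    reals.\<close>
  moreover have k: "0 < card X"
    using False finite_subset[OF terminals_in_verts pair_finite_verts] by (auto simp: card_gt_0_iff)
  moreover have "harm (card X) \<noteq> (0 :: real)"
    using harm_pos[OF k, where 'a = real] by linarith
  ultimately show ?thesis
    by simp
qed

text \<open>The difference of \<open>harm k\<close> and \<open>ln k\<close> converges to the
  Euler-Mascheroni constant, hence is bounded.\<close>

lemma harm_bigo_ln: "(\<lambda>k. 2 * harm k :: real) \<in> O(\<lambda>k. ln (real k))"
proof -
  have "(\<lambda>k. harm k - ln (real k)) \<in> O(\<lambda>_. 1)"
    using euler_mascheroni_LIMSEQ by (intro bigoI_tendsto[where c = euler_mascheroni]) auto
  also have "(\<lambda>_ :: nat. 1 :: real) \<in> O(\<lambda>k. ln (real k))"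
    by real_asymp
  finally have "(\<lambda>k. harm k - ln (real k)) \<in> O(\<lambda>k. ln (real k))" .
  from sum_in_bigo(1)[OF this, of "\<lambda>k. ln (real k)"] have "harm \<in> O(\<lambda>k. ln (real k))"
    by simp
  then show ?thesis
    by simp
qed

section \<open>The program on encoded instances\<close>

definition solve :: "nat list \<times> ((nat \<times> nat) \<times> int \<times> int) list \<times> nat \<times> nat list \<Rightarrow> (nat \<times> nat) list" where
  "solve inp = greedy_tree (fst inp) (scale_costs (fst (snd inp))) (fst (snd (snd inp))) (snd (snd (snd inp)))"

definition input_tuple :: "dst_input \<Rightarrow> nat list \<times> ((nat \<times> nat) \<times> int \<times> int) list \<times> nat \<times> nat list" where
  "input_tuple I = (vert_list I, map (\<lambda>e. (e, quotient_of (cost_of I e))) (edge_list I), root_of I, term_list I)"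

text \<open>The prescribed encoding of an instance is the class encoding of a tuple, so the closure
  rules for \<open>poly_time\<close> apply to \<open>solve\<close> as it stands.\<close>

lemma enc_input_eq: "enc_input I = encode (input_tuple I)"
proof -
  have "enc_list enc_nat xs = enc_list encode xs" for xs
    by (induction xs) auto
  moreover have "enc_list (\<lambda>e. Node (enc_edge e) (enc_rat (q e))) xs
      = enc_list encode (map (\<lambda>e. (e, quotient_of (q e))) xs)" for q xs
    by (induction xs) (auto simp: enc_edge_def enc_rat_def case_prod_unfold)
  ultimately show ?thesis
    unfolding enc_input_def input_tuple_def by simp
qed

lemma enc_list_edge_eq: "enc_list enc_edge es = encode es"
  by (induction es) (auto simp: enc_edge_def)

lemma solve_correct:
  assumes valid: "valid_input I" and qb: "quasi_bipartite (input_graph I) (root_of I) (input_terms I)"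
    and tree: "directed_steiner_tree (input_graph I) (root_of I) (input_terms I) F"
  shows "directed_steiner_tree (input_graph I) (root_of I) (input_terms I) (set (solve (input_tuple I)))"
    and "ereal (\<Sum>e\<in>set (solve (input_tuple I)). input_cost I e)
      \<le> ereal (2 * harm (card (input_terms I))) * opt_lp (input_graph I) (input_cost I) (root_of I) (input_terms I)"
proof -
  let ?es = "map (\<lambda>e. (e, quotient_of (cost_of I e))) (edge_list I)"
  have dst: "dst_instance (input_graph I) (input_cost I) (root_of I) (input_terms I)"
    using valid unfolding valid_input_def by blast
  have D: "0 < denominator ?es"
    by (rule scale_quotient_of)
  interpret greedy_input "input_graph I" "input_cost I" "root_of I" "term_list I" "vert_list I" "scale_costs ?es"
    "\<lambda>z. of_int z / of_int (denominator ?es)"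
  proof (rule greedy_input.intro)
    show "of_int z / of_int (denominator ?es) = input_cost I e" if "(e, z) \<in> set (scale_costs ?es)" for e z
      unfolding input_cost_def using that by (rule scale_quotient_of)
    show "parcs (input_graph I) = fst ` set (scale_costs ?es)"
      unfolding scale_quotient_of by (simp add: input_graph_def)
    show "real_of_int (a + b) / of_int (denominator ?es)
        = of_int a / of_int (denominator ?es) + of_int b / of_int (denominator ?es)" for a b
      by (simp add: add_divide_distrib)
    show "real_of_int (a * of_nat n) / of_int (denominator ?es) = of_int a / of_int (denominator ?es) * of_nat n" for a n
      by simp
    show "real_of_int a / of_int (denominator ?es) < of_int b / of_int (denominator ?es) \<longleftrightarrow> a < b" for a b
      using D by (simp add: divide_less_cancel)
  qed (use valid dst qb in \<open>simp_all add: valid_input_def input_terms_def input_graph_def\<close>)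
  have X: "set (term_list I) = input_terms I"
    unfolding input_terms_def ..
  have "\<forall>t\<in>input_terms I. reach (parcs (input_graph I)) (root_of I) t"
    using tree reach_mono[of F _ _ "parcs (input_graph I)"] unfolding directed_steiner_tree_iff[OF dst] by blast
  note t = greedy_tree_steiner[unfolded X, OF this]
  have "solve (input_tuple I) = greedy_tree (vert_list I) (scale_costs ?es) (root_of I) (term_list I)"
    unfolding solve_def input_tuple_def by simp
  with t show "directed_steiner_tree (input_graph I) (root_of I) (input_terms I) (set (solve (input_tuple I)))"
    and "ereal (\<Sum>e\<in>set (solve (input_tuple I)). input_cost I e)
      \<le> ereal (2 * harm (card (input_terms I))) * opt_lp (input_graph I) (input_cost I) (root_of I) (input_terms I)"
    by simp_all
qed

theorem theorem1:
  shows "(\<forall>(G :: 'a pair_pre_digraph) c r X. dst_instance G c r X \<and> quasi_bipartite G r X \<longrightarrow>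
            opt_dst G c r X \<le> ereal (2 * harm (card X)) * opt_lp G c r X)
    \<and> (\<lambda>k. 2 * harm k :: real) \<in> O(\<lambda>k. ln (real k))
    \<and> poly_time_solvable
        {I. valid_input I \<and> quasi_bipartite (input_graph I) (root_of I) (input_terms I) \<and>
            (\<exists>F. directed_steiner_tree (input_graph I) (root_of I) (input_terms I) F)}
        enc_input
        (\<lambda>I es. directed_steiner_tree (input_graph I) (root_of I) (input_terms I) (set es) \<and>
            ereal (\<Sum>e\<in>set es. input_cost I e)
              \<le> ereal (2 * harm (card (input_terms I)))
                * opt_lp (input_graph I) (input_cost I) (root_of I) (input_terms I))
        (enc_list enc_edge)"
proof (intro conjI allI impI)
  show "(\<lambda>k. 2 * harm k :: real) \<in> O(\<lambda>k. ln (real k))"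
    by (rule harm_bigo_ln)
  have "poly_time solve"
    unfolding solve_def[abs_def] by (intro poly_time_intros)
  then obtain P m where P: "\<And>x. runs P (encode x) (encode (solve x)) (m x)" and "poly_bounded m"
    by (rule poly_timeE) blast
  then obtain p where p: "\<And>x. m x \<le> poly p (sz x)"
    unfolding poly_bounded_def by blast
  show "poly_time_solvable
        {I. valid_input I \<and> quasi_bipartite (input_graph I) (root_of I) (input_terms I) \<and>
            (\<exists>F. directed_steiner_tree (input_graph I) (root_of I) (input_terms I) F)}
        enc_input
        (\<lambda>I es. directed_steiner_tree (input_graph I) (root_of I) (input_terms I) (set es) \<and>
            ereal (\<Sum>e\<in>set es. input_cost I e)
              \<le> ereal (2 * harm (card (input_terms I)))
                * opt_lp (input_graph I) (input_cost I) (root_of I) (input_terms I))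
        (enc_list enc_edge)"
    unfolding poly_time_solvable_def enc_input_eq enc_list_edge_eq
  proof (rule exI[of _ P], rule exI[of _ p], rule ballI)
    fix I
    assume I: "I \<in> {I. valid_input I \<and> quasi_bipartite (input_graph I) (root_of I) (input_terms I) \<and>
        (\<exists>F. directed_steiner_tree (input_graph I) (root_of I) (input_terms I) F)}"
    obtain t where "exec P (encode (input_tuple I)) (encode (solve (input_tuple I))) t" "t \<le> poly p (sz (input_tuple I))"
      using runs_le[OF P p, of "input_tuple I"] by (rule runsE)
    then show "\<exists>es t. exec P (encode (input_tuple I)) (encode es) t \<and> t \<le> poly p (sz (input_tuple I)) \<and>
        directed_steiner_tree (input_graph I) (root_of I) (input_terms I) (set es) \<and>
        ereal (\<Sum>e\<in>set es. input_cost I e)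
          \<le> ereal (2 * harm (card (input_terms I)))
            * opt_lp (input_graph I) (input_cost I) (root_of I) (input_terms I)"
      using I solve_correct by blast
  qed
qed (elim conjE, rule integrality_gap)

end
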